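(* In the setting described in the context, let $\{W_r,\mathcal S_r^o,\mathcal I_r\}_{r\ge1}$ be an admissible Galerkin scheme (i.e. satisfying (C), (CQ), (CD)), let the standing assumptions (R) and (D) hold, suppose that condition (H) holds and that $0\le\lambda_r^*<+\infty$ for all sufficiently large $r$. Then: $(1^\circ)$ For every sufficiently large $r$ there exist $u_r^*,v_r^*\in\mathcal S_r^o$ such that $$\lambda_r^*=\mathcal R(u_r^*,v_r^* )=\min_{v\in\mathcal S_r^o}\mathcal R(u_r^*,v)=\max_{u\in\mathcal S_r^o}\min_{v\in\mathcal S_r^o}\mathcal R(u,v).$$ Moreover, $$\langle\mathcal F(u_r^*,\lambda_r^* ),\zeta\rangle=0\quad\forall\zeta\in W_r,\qquad \langle D_u\mathcal F(u_r^*,\lambda_r^* )\xi,v_r^*\rangle=0\quad\forall\xi\in W_r.$$ (That is, $(u_r^*,v_r^* )$ is a finite-dimensional saddle-point pair at the level $\lambda_r^*$.) $(2^\circ)$ Assume, in addition, that along a subsequence $\lambda_r^*\to\hat\lambda^*\in\mathbb R$, and that $\mathcal R$ satisfies the extended $(PS)_e$-condition at the level $\hat\lambda^*$. Then, up to a further subsequence and a positive rescaling of $v_r^*$, $$u_r^*\to u^*\ \text{strongly in }W,\qquad v_r^*\rightharpoonup v^*\ \text{weakly in }W,$$ where $u^*\in\mathcal U^o$ and $v^*\in\mathcal S\setminus\{0\}$. Moreover, $$\mathcal F(u^*,\hat\lambda^* )=0\ \text{in }W^*,\qquad \langle D_u\mathcal F(u^*,\hat\lambda^* )\xi,v^*\rangle=0\quad\forall\xi\in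 W.$$
   Context: Setting. $W$ is a reflexive Banach space with dual $W^*$ and duality pairing $\langle\cdot,\cdot\rangle$; $\mathcal C^0$ is an ordered Banach function space ($W$ and $\mathcal C^0$ are regarded as subspaces of a common vector space, so that $W\cap\mathcal C^0$ makes sense). $\mathcal S^o\subset W\cap\mathcal C^0$ is a convex cone, $\mathcal S:=\overline{\mathcal S^o}^{\,\mathcal C^0}\cap W$, and $\overline{\operatorname{span}\mathcal S^o}^{\,W}=W$. A subclass $\mathcal U^o\subset\mathcal S^o$ is fixed. $\mathcal A,\mathcal G:W\to W^*$ are continuous and are continuously Fréchet differentiable on $\mathcal U^o$. Put $\mathcal F(u,\lambda):=\mathcal A(u)-\lambda\mathcal G(u)$, $\lambda\in\mathbb R$, and $D_u\mathcal F(u,\lambda)\xi=D_u\mathcal A(u)\xi-\lambda D_u\mathcal G(u)\xi$. The extended Rayleigh quotient is $$\mathcal R(u,v):=\frac{\langle\mathcal A(u),v\rangle}{\langle\mathcal G(u),v\rangle},\qquad \langle\mathcal G(u),v\rangle\ne0.$$ Standing assumptions. (R): if $u\in\mathcal S^o$ weakly satisfies $\mathcal F(u,\lambda)=0$, then $u\in\mathcal U^o$. (D): $\langle\mathcal G(u),v\rangle>0$ for every $(u,v)\in\mathcal S^o\times(\mathcal S\setminus\{0\})$. Galerkin scheme. $W_r\subset W$ ($r\ge1$) are subspaces of finite dimension $N_r$ with $\bigcup_{r}W_r$ dense in $W$ in the sense that every $\xi\in W$ is the strong limit of some $\xi_r\in W_r$; $\mathcal I_r:\mathcal C^0\to W_r$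 are interpolation operators. (C): (c1) for every $r\ge1$, $\mathcal S_r^o\subset W_r$ is a nonempty open cone, $\mathcal S_r:=\overline{\mathcal S_r^o}^{\,W_r}$, and $\mathcal S_r\subset\mathcal S$; (c2) there is a basis $\{\eta_1,\dots,\eta_{N_r}\}$ of $W_r$ with $\mathcal S_r^o=\{\sum_i v^i\eta_i: v^i>0,\ i=1,\dots,N_r\}$; (c3) for every $u\in\mathcal U^o$, $\mathcal I_ru$ is well defined and $\mathcal I_ru\in\mathcal S_r^o$ for all sufficiently large $r$. (CQ): for every $r\ge1$, $\langle\mathcal G(u),v\rangle>0$ for all $(u,v)\in\mathcal S_r^o\times(\mathcal S_r\setminus\{0\})$; moreover the finite-dimensional restrictions are $C^1$ on $\mathcal S_r^o$, i.e. for each $v\in W_r$ the functions $u\mapsto\langle\mathcal A(u),v\rangle$ and $u\mapsto\langle\mathcal G(u),v\rangle$ are $C^1$ on the open set $\mathcal S_r^o\subset W_r$; in particular $\mathcal R$ is $C^1$ on $\mathcal S_r^o\times\mathcal S_r^o$. For $u\in\mathcal S_r^o$ and $\xi,v\in W_r$, $\langle D_u\mathcal F(u,\lambda)\xi,v\rangle$ denotes the derivative of $u\mapsto\langle\mathcal F(u,\lambda),v\rangle$ at $u$ in direction $\xi$. (CD): for every $u\in\mathcal U^o$, $v\in\mathcal S$, $\xi\in W$, $\lambda\in\mathbb R$: whenever $u_n,v_n\in\mathcal S_{r_n}^o$, $\xi_n\in W_{r_n}$, $r_n\to\infty$, $\lambda_n\to\lambda$, $u_n\to u$ in $W$, $\xi_n\to\xi$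 in $W$, $v_n\rightharpoonup v$ weakly in $W$, one has $\langle D_u\mathcal F(u_n,\lambda_n)\xi_n,v_n\rangle\to\langle D_u\mathcal F(u,\lambda)\xi,v\rangle$. The scheme is admissible if (C), (CQ), (CD) hold. For $u\in\mathcal S_r^o$ put $\lambda_r(u):=\inf_{v\in\mathcal S_r\setminus\{0\}}\mathcal R(u,v)$ and $\lambda_r^*:=\sup_{u\in\mathcal S_r^o}\lambda_r(u)$. (H): for all sufficiently large $r$: (h1) if $\lambda_r^*<+\infty$, there exists $\alpha_r<\lambda_r^*$ such that $K_{r,\alpha_r}:=\{u\in\mathcal S_r^o:\lambda_r(u)\ge\alpha_r\}$ has compact closure in $W_r$ and this closure is contained in $\mathcal S_r^o$; (h2) if $u\in\mathcal S_r^o$, $v\in\mathcal S_r\setminus\{0\}$, $\mathcal R(u,v)=\lambda_r^*<+\infty$ and $D_u\mathcal R(u,v)(\xi)=0$ for all $\xi\in W_r$, then $v\in\mathcal S_r^o$. Extended $(PS)_e$-condition at level $\lambda\in\mathbb R$: every sequence $r_n\to\infty$ and every sequence $(u_n,v_n)\in\mathcal S_{r_n}^o\times\mathcal S_{r_n}^o$ with $\mathcal R(u_n,v_n)\to\lambda$, $D_u\mathcal R(u_n,v_n)(\xi)=0$ for all $\xi\in W_{r_n}$, and $D_v\mathcal R(u_n,v_n)(\zeta)=0$ for all $\zeta\in W_{r_n}$, has a subsequence and numbers $t_n>0$ such that, after replacing $v_n$ by $t_nv_n$, $u_n\to\bar u$ strongly in $W$ and $v_n\rightharpoonup\bar v$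 weakly in $W$, with $\bar u\in\mathcal S^o$ and $\bar v\in\mathcal S\setminus\{0\}$. *)

theory Defs
  imports "HOL-Analysis.Analysis"
begin

text \<open>
  The dual of a normed space \<open>'w\<close> is the type \<open>'w \<Rightarrow>\<^sub>L real\<close>; the duality pairing is
  application of the functional.
\<close>

definition reflexive_space :: "'w::real_normed_vector itself \<Rightarrow> bool" where
  "reflexive_space _ \<longleftrightarrow>
     (\<forall>\<phi> :: ('w \<Rightarrow>\<^sub>L real) \<Rightarrow>\<^sub>L real. \<exists>w::'w. \<forall>f::'w \<Rightarrow>\<^sub>L real. blinfun_apply \<phi> f = blinfun_apply f w)"

definition weakly_tendsto :: "(nat \<Rightarrow> 'w::real_normed_vector) \<Rightarrow> 'w \<Rightarrow> bool" where
  "weakly_tendsto x l \<longleftrightarrow> (\<forall>f :: 'w \<Rightarrow>\<^sub>L real. (\<lambda>n. blinfun_apply f (x n)) \<longlonglongrightarrow> blinfun_apply f l)"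

text \<open>
  Invariance under strictly positive scalars only: the library's \<^const>\<open>cone\<close> and \<^const>\<open>conic\<close>
  force \<open>0\<close> into every nonempty cone, which is incompatible with open cones.
\<close>

definition pos_cone :: "'w::real_vector set \<Rightarrow> bool" where
  "pos_cone K \<longleftrightarrow> (\<forall>x\<in>K. \<forall>t>0. t *\<^sub>R x \<in> K)"

definition C1_frechet_on :: "'w::real_normed_vector set \<Rightarrow> ('w \<Rightarrow> 'b::real_normed_vector) \<Rightarrow> bool" where
  "C1_frechet_on U f \<longleftrightarrow>
     (\<forall>u\<in>U. f differentiable (at u)) \<and>
     continuous_on U (\<lambda>u. Blinfun (frechet_derivative f (at u)))"

text \<open>
  \<open>f\<close> is \<open>C\<^sup>1\<close> on a relatively open subset \<open>U\<close> of the finite-dimensional subspace \<open>V\<close>.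
  Only the restriction of \<open>f' u\<close> to \<open>V\<close> is determined by \<open>f\<close>. Asking for functionals on the
  whole space is no restriction: compose the derivative on \<open>V\<close> with a continuous
  linear projection onto \<open>V\<close>.
\<close>

definition C1_in_subspace :: "'w::real_normed_vector set \<Rightarrow> 'w set \<Rightarrow> ('w \<Rightarrow> real) \<Rightarrow> bool" where
  "C1_in_subspace V U f \<longleftrightarrow>
     (\<exists>f' :: 'w \<Rightarrow> 'w \<Rightarrow>\<^sub>L real.
        (\<forall>u\<in>U. (f has_derivative blinfun_apply (f' u)) (at u within V)) \<and> continuous_on U f')"

definition dir_deriv :: "('w::real_vector \<Rightarrow> real) \<Rightarrow> 'w \<Rightarrow> 'w \<Rightarrow> real" where
  "dir_deriv f u \<xi> = deriv (\<lambda>t::real. f (u + t *\<^sub>R \<xi>)) 0"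

definition eqF :: "('w::real_normed_vector \<Rightarrow> 'w \<Rightarrow>\<^sub>L real) \<Rightarrow> ('w \<Rightarrow> 'w \<Rightarrow>\<^sub>L real) \<Rightarrow>
    'w \<Rightarrow> real \<Rightarrow> 'w \<Rightarrow>\<^sub>L real" where
  "eqF A G u \<mu> = A u - \<mu> *\<^sub>R G u"

text \<open>The derivative of \<open>\<F>\<close> in the full space, meaningful for \<open>u \<in> \<U>\<^sup>o\<close>.\<close>

definition DeqF :: "('w::real_normed_vector \<Rightarrow> 'w \<Rightarrow>\<^sub>L real) \<Rightarrow> ('w \<Rightarrow> 'w \<Rightarrow>\<^sub>L real) \<Rightarrow>
    'w \<Rightarrow> real \<Rightarrow> 'w \<Rightarrow> 'w \<Rightarrow>\<^sub>L real" where
  "DeqF A G u \<mu> \<xi> =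
     frechet_derivative A (at u) \<xi> - \<mu> *\<^sub>R frechet_derivative G (at u) \<xi>"

text \<open>
  The pairing \<open>\<langle>D\<^sub>u\<F>(u,\<lambda>)\<xi>,v\<rangle>\<close> at discrete points \<open>u \<in> \<S>\<^sub>r\<^sup>o\<close>, with \<open>\<xi>, v \<in> W\<^sub>r\<close>;
  there \<open>\<A>\<close> and \<open>\<G>\<close> need not be differentiable as maps on the full space.
\<close>

definition DeqF_discr :: "('w::real_normed_vector \<Rightarrow> 'w \<Rightarrow>\<^sub>L real) \<Rightarrow> ('w \<Rightarrow> 'w \<Rightarrow>\<^sub>L real) \<Rightarrow>
    'w \<Rightarrow> real \<Rightarrow> 'w \<Rightarrow> 'w \<Rightarrow> real" where
  "DeqF_discr A G u \<mu> \<xi> v = dir_deriv (\<lambda>w. eqF A G w \<mu> v) u \<xi>"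

definition rayleigh :: "('w::real_normed_vector \<Rightarrow> 'w \<Rightarrow>\<^sub>L real) \<Rightarrow> ('w \<Rightarrow> 'w \<Rightarrow>\<^sub>L real) \<Rightarrow>
    'w \<Rightarrow> 'w \<Rightarrow> real" where
  "rayleigh A G u v = A u v / G u v"

definition Du_rayleigh :: "('w::real_normed_vector \<Rightarrow> 'w \<Rightarrow>\<^sub>L real) \<Rightarrow> ('w \<Rightarrow> 'w \<Rightarrow>\<^sub>L real) \<Rightarrow>
    'w \<Rightarrow> 'w \<Rightarrow> 'w \<Rightarrow> real" where
  "Du_rayleigh A G u v \<xi> = dir_deriv (\<lambda>w. rayleigh A G w v) u \<xi>"

definition Dv_rayleigh :: "('w::real_normed_vector \<Rightarrow> 'w \<Rightarrow>\<^sub>L real) \<Rightarrow> ('w \<Rightarrow> 'w \<Rightarrow>\<^sub>L real) \<Rightarrow>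
    'w \<Rightarrow> 'w \<Rightarrow> 'w \<Rightarrow> real" where
  "Dv_rayleigh A G u v \<zeta> = dir_deriv (\<lambda>w. rayleigh A G u w) v \<zeta>"

text \<open>
  \<open>W\<close> (the type \<open>'w\<close>) and \<open>\<C>\<^sup>0\<close> (the type \<open>'c\<close>) are subspaces of a common vector space \<open>'e\<close>
  through the injective linear maps \<open>jW\<close> and \<open>jC\<close>. Subsets of \<open>W \<inter> \<C>\<^sup>0\<close> are represented as
  subsets of \<open>'w\<close> whose image under \<open>jW\<close> lies in the range of \<open>jC\<close>.
  \<open>coneS jW jC So\<close> is the closure of \<open>\<S>\<^sup>o\<close> in \<open>\<C>\<^sup>0\<close>, intersected with \<open>W\<close>.
\<close>

definition coneS :: "('w \<Rightarrow> 'e) \<Rightarrow> ('c::topological_space \<Rightarrow> 'e) \<Rightarrow> 'w set \<Rightarrow> 'w set" where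
  "coneS jW jC So = {w. jW w \<in> jC ` closure {c. jC c \<in> jW ` So}}"

definition basic_setting ::
  "('w::banach \<Rightarrow> 'e::real_vector) \<Rightarrow> ('c::{banach,ordered_real_vector} \<Rightarrow> 'e) \<Rightarrow>
   'w set \<Rightarrow> 'w set \<Rightarrow> ('w \<Rightarrow> 'w \<Rightarrow>\<^sub>L real) \<Rightarrow> ('w \<Rightarrow> 'w \<Rightarrow>\<^sub>L real) \<Rightarrow> bool" where
  "basic_setting jW jC So Uo A G \<longleftrightarrow>
     reflexive_space TYPE('w) \<and>
     linear jW \<and> inj jW \<and> linear jC \<and> inj jC \<and>
     jW ` So \<subseteq> range jC \<and> convex So \<and> pos_cone So \<and> closure (span So) = UNIV \<and>
     Uo \<subseteq> So \<and>
     continuous_on UNIV A \<and> continuous_on UNIV G \<and>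
     C1_frechet_on Uo A \<and> C1_frechet_on Uo G"

definition cond_R ::
  "'w::real_normed_vector set \<Rightarrow> 'w set \<Rightarrow> ('w \<Rightarrow> 'w \<Rightarrow>\<^sub>L real) \<Rightarrow> ('w \<Rightarrow> 'w \<Rightarrow>\<^sub>L real) \<Rightarrow> bool" where
  "cond_R So Uo A G \<longleftrightarrow>
     (\<forall>u\<in>So. \<forall>\<mu>. (\<forall>\<zeta>. eqF A G u \<mu> \<zeta> = 0) \<longrightarrow> u \<in> Uo)"

definition cond_D :: "'w::real_normed_vector set \<Rightarrow> 'w set \<Rightarrow> ('w \<Rightarrow> 'w \<Rightarrow>\<^sub>L real) \<Rightarrow> bool" where
  "cond_D So S G \<longleftrightarrow> (\<forall>u\<in>So. \<forall>v\<in>S - {0}. G u v > 0)"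

text \<open>Schemes are indexed by \<open>r \<ge> 1\<close>; values at \<open>r = 0\<close> are never used.\<close>

definition galerkin_spaces ::
  "(nat \<Rightarrow> 'w::real_normed_vector set) \<Rightarrow> (nat \<Rightarrow> 'c \<Rightarrow> 'w) \<Rightarrow> bool" where
  "galerkin_spaces W I \<longleftrightarrow>
     (\<forall>r\<ge>1. subspace (W r) \<and> (\<exists>B. finite B \<and> span B = W r)) \<and>
     (\<forall>\<xi>. \<exists>\<xi>r. (\<forall>r\<ge>1. \<xi>r r \<in> W r) \<and> \<xi>r \<longlonglongrightarrow> \<xi>) \<and>
     (\<forall>r\<ge>1. \<forall>c. I r c \<in> W r)"

text \<open>The closure of \<open>\<S>\<^sub>r\<^sup>o\<close> in \<open>W\<^sub>r\<close>.\<close>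

definition Sr :: "(nat \<Rightarrow> 'w::real_normed_vector set) \<Rightarrow> (nat \<Rightarrow> 'w set) \<Rightarrow> nat \<Rightarrow> 'w set" where
  "Sr W Sro r = (top_of_set (W r)) closure_of (Sro r)"

definition cond_C ::
  "('w::real_normed_vector \<Rightarrow> 'e) \<Rightarrow> ('c::real_normed_vector \<Rightarrow> 'e) \<Rightarrow> 'w set \<Rightarrow> 'w set \<Rightarrow>
   (nat \<Rightarrow> 'w set) \<Rightarrow> (nat \<Rightarrow> 'w set) \<Rightarrow> (nat \<Rightarrow> 'c \<Rightarrow> 'w) \<Rightarrow> bool" where
  "cond_C jW jC So Uo W Sro I \<longleftrightarrow>
     (\<forall>r\<ge>1. Sro r \<subseteq> W r \<and> Sro r \<noteq> {} \<and> openin (top_of_set (W r)) (Sro r) \<and> pos_cone (Sro r) \<and>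
            Sr W Sro r \<subseteq> coneS jW jC So) \<and>
     (\<forall>r\<ge>1. \<exists>\<eta> :: nat \<Rightarrow> 'w.
        inj_on \<eta> {1..dim (W r)} \<and> independent (\<eta> ` {1..dim (W r)}) \<and>
        span (\<eta> ` {1..dim (W r)}) = W r \<and>
        Sro r = {\<Sum>i=1..dim (W r). v i *\<^sub>R \<eta> i | v. \<forall>i\<in>{1..dim (W r)}. v i > 0}) \<and>
     (\<forall>u\<in>Uo. \<forall>c. jC c = jW u \<longrightarrow> (\<forall>\<^sub>F r in sequentially. I r c \<in> Sro r))"

definition cond_CQ ::
  "('w::real_normed_vector \<Rightarrow> 'w \<Rightarrow>\<^sub>L real) \<Rightarrow> ('w \<Rightarrow> 'w \<Rightarrow>\<^sub>L real) \<Rightarrow>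
   (nat \<Rightarrow> 'w set) \<Rightarrow> (nat \<Rightarrow> 'w set) \<Rightarrow> bool" where
  "cond_CQ A G W Sro \<longleftrightarrow>
     (\<forall>r\<ge>1. (\<forall>u\<in>Sro r. \<forall>v\<in>Sr W Sro r - {0}. G u v > 0) \<and>
            (\<forall>v\<in>W r. C1_in_subspace (W r) (Sro r) (\<lambda>u. A u v) \<and>
                     C1_in_subspace (W r) (Sro r) (\<lambda>u. G u v)))"

definition cond_CD ::
  "'w::real_normed_vector set \<Rightarrow> 'w set \<Rightarrow> ('w \<Rightarrow> 'w \<Rightarrow>\<^sub>L real) \<Rightarrow> ('w \<Rightarrow> 'w \<Rightarrow>\<^sub>L real) \<Rightarrow>
   (nat \<Rightarrow> 'w set) \<Rightarrow> (nat \<Rightarrow> 'w set) \<Rightarrow> bool" where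
  "cond_CD Uo S A G W Sro \<longleftrightarrow>
     (\<forall>u\<in>Uo. \<forall>v\<in>S. \<forall>\<xi> \<mu>. \<forall>\<rho> un vn \<xi>n \<mu>n.
        (\<forall>n. \<rho> n \<ge> 1 \<and> un n \<in> Sro (\<rho> n) \<and> vn n \<in> Sro (\<rho> n) \<and> \<xi>n n \<in> W (\<rho> n)) \<and>
        filterlim \<rho> at_top sequentially \<and> \<mu>n \<longlonglongrightarrow> \<mu> \<and>
        un \<longlonglongrightarrow> u \<and> \<xi>n \<longlonglongrightarrow> \<xi> \<and> weakly_tendsto vn v \<longrightarrow>
        (\<lambda>n. DeqF_discr A G (un n) (\<mu>n n) (\<xi>n n) (vn n)) \<longlonglongrightarrow> DeqF A G u \<mu> \<xi> v)"

definition lam ::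
  "('w::real_normed_vector \<Rightarrow> 'w \<Rightarrow>\<^sub>L real) \<Rightarrow> ('w \<Rightarrow> 'w \<Rightarrow>\<^sub>L real) \<Rightarrow>
   (nat \<Rightarrow> 'w set) \<Rightarrow> (nat \<Rightarrow> 'w set) \<Rightarrow> nat \<Rightarrow> 'w \<Rightarrow> ereal" where
  "lam A G W Sro r u = (INF v \<in> Sr W Sro r - {0}. ereal (rayleigh A G u v))"

definition lam_star ::
  "('w::real_normed_vector \<Rightarrow> 'w \<Rightarrow>\<^sub>L real) \<Rightarrow> ('w \<Rightarrow> 'w \<Rightarrow>\<^sub>L real) \<Rightarrow>
   (nat \<Rightarrow> 'w set) \<Rightarrow> (nat \<Rightarrow> 'w set) \<Rightarrow> nat \<Rightarrow> ereal" where
  "lam_star A G W Sro r = (SUP u \<in> Sro r. lam A G W Sro r u)"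

definition cond_H ::
  "('w::real_normed_vector \<Rightarrow> 'w \<Rightarrow>\<^sub>L real) \<Rightarrow> ('w \<Rightarrow> 'w \<Rightarrow>\<^sub>L real) \<Rightarrow>
   (nat \<Rightarrow> 'w set) \<Rightarrow> (nat \<Rightarrow> 'w set) \<Rightarrow> bool" where
  "cond_H A G W Sro \<longleftrightarrow>
     (\<forall>\<^sub>F r in sequentially.
        (lam_star A G W Sro r < \<infinity> \<longrightarrow>
           (\<exists>\<alpha>::real. ereal \<alpha> < lam_star A G W Sro r \<and>
              (let K = {u \<in> Sro r. lam A G W Sro r u \<ge> ereal \<alpha>};
                   clK = (top_of_set (W r)) closure_of K
               in compact clK \<and> clK \<subseteq> Sro r))) \<and>
        (\<forall>u\<in>Sro r. \<forall>v\<in>Sr W Sro r - {0}.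
           ereal (rayleigh A G u v) = lam_star A G W Sro r \<and> lam_star A G W Sro r < \<infinity> \<and>
           (\<forall>\<xi>\<in>W r. Du_rayleigh A G u v \<xi> = 0) \<longrightarrow> v \<in> Sro r))"

definition PS_e ::
  "'w::real_normed_vector set \<Rightarrow> 'w set \<Rightarrow> ('w \<Rightarrow> 'w \<Rightarrow>\<^sub>L real) \<Rightarrow> ('w \<Rightarrow> 'w \<Rightarrow>\<^sub>L real) \<Rightarrow>
   (nat \<Rightarrow> 'w set) \<Rightarrow> (nat \<Rightarrow> 'w set) \<Rightarrow> real \<Rightarrow> bool" where
  "PS_e So S A G W Sro \<mu> \<longleftrightarrow>
     (\<forall>\<rho> u v.
        filterlim \<rho> at_top sequentially \<and>
        (\<forall>n. \<rho> n \<ge> 1 \<and> u n \<in> Sro (\<rho> n) \<and> v n \<in> Sro (\<rho> n)) \<and>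
        (\<lambda>n. rayleigh A G (u n) (v n)) \<longlonglongrightarrow> \<mu> \<and>
        (\<forall>n. \<forall>\<xi>\<in>W (\<rho> n). Du_rayleigh A G (u n) (v n) \<xi> = 0) \<and>
        (\<forall>n. \<forall>\<zeta>\<in>W (\<rho> n). Dv_rayleigh A G (u n) (v n) \<zeta> = 0) \<longrightarrow>
        (\<exists>(\<sigma> :: nat \<Rightarrow> nat) (t :: nat \<Rightarrow> real). \<exists>ub\<in>So. \<exists>vb\<in>S - {0}.
           strict_mono \<sigma> \<and> (\<forall>k. t k > 0) \<and>
           (\<lambda>k. u (\<sigma> k)) \<longlonglongrightarrow> ub \<and> weakly_tendsto (\<lambda>k. t k *\<^sub>R v (\<sigma> k)) vb))"

text \<open>
  In the chain \<open>\<lambda>\<^sub>r\<^sup>* = \<R>(us,vs) = min\<^sub>v \<R>(us,v) = max\<^sub>u min\<^sub>v \<R>(u,v)\<close> over \<open>\<S>\<^sub>r\<^sup>o\<close>, the minimum at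
  \<open>us\<close> is attained at \<open>vs\<close> and the maximum over \<open>u\<close> at \<open>us\<close>. For a general \<open>u\<close>, the infimum over
  the open cone is usually not attained there, as \<open>\<R>(u,_)\<close> is a quotient of linear
  functionals. So the inner minimum in the last term is an infimum.
\<close>

definition discrete_saddle_pair ::
  "('w::real_normed_vector \<Rightarrow> 'w \<Rightarrow>\<^sub>L real) \<Rightarrow> ('w \<Rightarrow> 'w \<Rightarrow>\<^sub>L real) \<Rightarrow>
   (nat \<Rightarrow> 'w set) \<Rightarrow> (nat \<Rightarrow> 'w set) \<Rightarrow> nat \<Rightarrow> 'w \<Rightarrow> 'w \<Rightarrow> bool" where
  "discrete_saddle_pair A G W Sro r us vs \<longleftrightarrow>
     us \<in> Sro r \<and> vs \<in> Sro r \<and>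
     lam_star A G W Sro r = ereal (rayleigh A G us vs) \<and>
     is_arg_min (\<lambda>v. rayleigh A G us v) (\<lambda>v. v \<in> Sro r) vs \<and>
     is_arg_max (\<lambda>u. INF v\<in>Sro r. ereal (rayleigh A G u v)) (\<lambda>u. u \<in> Sro r) us \<and>
     lam_star A G W Sro r = (SUP u\<in>Sro r. INF v\<in>Sro r. ereal (rayleigh A G u v)) \<and>
     (\<forall>\<zeta>\<in>W r. eqF A G us (real_of_ereal (lam_star A G W Sro r)) \<zeta> = 0) \<and>
     (\<forall>\<xi>\<in>W r. DeqF_discr A G us (real_of_ereal (lam_star A G W Sro r)) \<xi> vs = 0)"

end

theory Submission
  imports Defs
begin

text \<open>
  For fixed \<open>u\<close>, \<open>\<R>(u,v)\<close> is a weighted mean of the quotients \<open>\<R>(u,\<eta>\<^sub>i)\<close>, so \<open>\<lambda>\<^sub>r\<close> is the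
  minimum of finitely many quotients, and its supremum \<open>\<lambda>\<^sub>r\<^sup>*\<close> is attained at some \<open>u\<^sup>*\<close> by (h1).
  Since no direction increases all active quotients at \<open>u\<^sup>*\<close>, Gordan's alternative gives a nonzero
  \<open>v \<in> \<S>\<^sub>r\<close>, supported on active indices, with \<open>D\<^sub>u\<R>(u\<^sup>*,v) = 0\<close>. By (h2) \<open>v\<close> is interior, so
  every index is active, which says that \<open>\<F>(u\<^sup>*,\<lambda>\<^sub>r\<^sup>*) = 0\<close> on \<open>W\<^sub>r\<close>. Hence \<open>\<R>(u\<^sup>*,\<cdot>)\<close> is constant
  and \<open>D\<^sub>v\<R>(u\<^sup>*,v) = 0\<close> as well, so the (PS) condition applies to the pairs. Both equations pass to
  the limit by density of the \<open>W\<^sub>r\<close>, continuity of \<open>\<A>\<close> and \<open>\<G>\<close>, and (CD).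
\<close>

section \<open>Gordan's theorem of the alternative\<close>

text \<open>Induction on \<open>J\<close> with \<open>V\<close> arbitrary: the step restricts the
  other functionals to the kernel of the new one, \<open>L k\<close>, and corrects the outcome along
  a vector \<open>y\<close> with \<open>L k y = 1\<close>.\<close>

lemma gordan_alternative:
  fixes L :: "'i \<Rightarrow> 'a::real_vector \<Rightarrow> real"
  assumes "finite J" and "\<And>i. i \<in> J \<Longrightarrow> linear (L i)" and "subspace V"
  shows "(\<exists>x\<in>V. \<forall>i\<in>J. L i x > 0) \<or>
    (\<exists>p. (\<forall>i\<in>J. p i \<ge> 0) \<and> (\<exists>i\<in>J. p i > 0) \<and> (\<forall>x\<in>V. (\<Sum>i\<in>J. p i * L i x) = 0))"
  using assms
proof (induction J arbitrary: V rule: finite_induct)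
  case empty
  then show ?case using subspace_0 by blast
next
  case (insert k J)
  have linJ: "linear (L i)" if "i \<in> J" for i using insert.prems that by simp
  have link: "linear (L k)" using insert.prems by simp
  have sumk: "(\<Sum>i\<in>insert k J. (p(k := c)) i * L i x) = c * L k x + (\<Sum>i\<in>J. p i * L i x)" for p c x
  proof -
    have "(\<Sum>i\<in>J. (p(k := c)) i * L i x) = (\<Sum>i\<in>J. p i * L i x)"
      by (rule sum.cong) (use insert.hyps in auto)
    then show ?thesis using insert.hyps by simp
  qed
  have extend: ?case
    if "\<forall>i\<in>J. p i \<ge> 0" "\<exists>i\<in>J. p i > 0" "c \<ge> 0" "\<forall>x\<in>V. c * L k x + (\<Sum>i\<in>J. p i * L i x) = 0" for p c
  proof (intro disjI2 exI conjI)
    show "\<forall>i\<in>insert k J. (p(k := c)) i \<ge> 0" using that by auto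
    show "\<exists>i\<in>insert k J. (p(k := c)) i > 0" using that insert.hyps by auto
    show "\<forall>x\<in>V. (\<Sum>i\<in>insert k J. (p(k := c)) i * L i x) = 0" using that(4) unfolding sumk .
  qed
  show ?case
  proof (cases "\<forall>x\<in>V. L k x = 0")
    \<comment> \<open>If \<open>L k\<close> vanishes on \<open>V\<close>, the multiplier
      concentrated at \<open>k\<close> works.\<close>
    case True
    show ?thesis
    proof (intro disjI2 exI conjI)
      show "\<forall>i\<in>insert k J. ((\<lambda>_. 0)(k := 1)) i \<ge> (0::real)" by auto
      show "\<exists>i\<in>insert k J. ((\<lambda>_. 0)(k := 1)) i > (0::real)" by auto
      show "\<forall>x\<in>V. (\<Sum>i\<in>insert k J. ((\<lambda>_. 0)(k := 1)) i * L i x) = 0"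
        unfolding sumk using True by simp
    qed
  next
    case False
    then obtain z where z: "z \<in> V" "L k z \<noteq> 0" by blast
    define y where "y = (1 / L k z) *\<^sub>R z"
    have y: "y \<in> V" "L k y = 1"
      using z insert.prems(2) link by (auto simp: y_def subspace_scale linear_scale)
    have "subspace {x. L k x = 0}" using link by (rule linear_subspace_kernel)
    then have "subspace (V \<inter> {x. L k x = 0})" by (rule subspace_inter[OF insert.prems(2)])
    from insert.IH[OF linJ this] consider
        x where "x \<in> V" "L k x = 0" "\<forall>i\<in>J. L i x > 0"
      | p where "\<forall>i\<in>J. p i \<ge> 0" "\<exists>i\<in>J. p i > 0"
          "\<forall>x\<in>V \<inter> {x. L k x = 0}. (\<Sum>i\<in>J. p i * L i x) = 0"
      by blast
    then show ?thesis
    proof cases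
      case (1 x)
      \<comment> \<open>A small step along \<open>y\<close> keeps the strict inequalities on
        \<open>J\<close> and makes \<open>L k\<close> positive, since
        \<open>L k x = 0\<close>.\<close>
      have "\<forall>\<^sub>F e in at_right (0::real). L i x + e * L i y > 0" if "i \<in> J" for i
      proof -
        have "((\<lambda>e. L i x + e * L i y) \<longlongrightarrow> L i x + 0 * L i y) (at_right 0)"
          by (intro tendsto_intros)
        then show ?thesis by (rule order_tendstoD(1)) (use 1 that in simp)
      qed
      then have "\<forall>\<^sub>F e in at_right (0::real). (\<forall>i\<in>J. L i x + e * L i y > 0) \<and> e > 0"
        using insert.hyps(1) by (intro eventually_conj eventually_ball_finite)
          (auto simp: eventually_at_right_less)
      then obtain e where e: "\<forall>i\<in>J. L i x + e * L i y > 0" "e > (0::real)"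
        using eventually_happens'[OF trivial_limit_at_right_real] by blast
      have L: "L i (x + e *\<^sub>R y) = L i x + e * L i y" if "linear (L i)" for i
        using that by (simp add: linear_add linear_scale)
      have "x + e *\<^sub>R y \<in> V"
        using 1 y insert.prems(2) by (simp add: subspace_add subspace_scale)
      moreover have "\<forall>i\<in>insert k J. L i (x + e *\<^sub>R y) > 0"
        using e 1 y linJ link by (auto simp: L)
      ultimately show ?thesis by blast
    next
      case (2 p)
      \<comment> \<open>The combination vanishes on the kernel of \<open>L k\<close> in
        \<open>V\<close>, so on \<open>V\<close> it is a multiple of \<open>L k\<close>; evaluation
        at \<open>y\<close> gives the factor.\<close>
      define c where "c = (\<Sum>i\<in>J. p i * L i y)"
      have c: "(\<Sum>i\<in>J. p i * L i x) = c * L k x" if "x \<in> V" for x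
      proof -
        have "x - L k x *\<^sub>R y \<in> V"
          using that y insert.prems(2) by (simp add: subspace_diff subspace_scale)
        moreover have "L k (x - L k x *\<^sub>R y) = 0"
          using link y by (simp add: linear_diff linear_scale)
        ultimately have "(\<Sum>i\<in>J. p i * L i (x - L k x *\<^sub>R y)) = 0" using 2 by blast
        moreover have "(\<Sum>i\<in>J. p i * L i (x - L k x *\<^sub>R y)) = (\<Sum>i\<in>J. p i * L i x - L k x * (p i * L i y))"
          by (rule sum.cong) (auto simp: linJ linear_diff linear_scale algebra_simps)
        ultimately show ?thesis
          by (simp add: sum_subtractf c_def sum_distrib_left mult.commute)
      qed
      show ?thesis
      \<comment> \<open>For \<open>c \<le> 0\<close> the weight \<open>-c\<close> at
        \<open>k\<close> completes the multiplier. For \<open>c > 0\<close> the induction hypothesis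
        is applied again, now to \<open>V\<close> itself: a vector positive for all of
        \<open>J\<close> makes \<open>c * L k x\<close> a positive sum, and a multiplier for
        \<open>J\<close> extends by weight 0.\<close>
      proof (cases "c \<le> 0")
        case True
        show ?thesis by (rule extend[OF 2(1,2), of "-c"]) (use True c in auto)
      next
        case False
        from insert.IH[OF linJ insert.prems(2)] show ?thesis
        proof
          assume "\<exists>x\<in>V. \<forall>i\<in>J. L i x > 0"
          then obtain x where x: "x \<in> V" "\<forall>i\<in>J. L i x > 0" by blast
          from 2(2) obtain j where j: "j \<in> J" "p j > 0" by blast
          have "(\<Sum>i\<in>J. p i * L i x) > 0"
            by (rule sum_pos2[OF insert.hyps(1) j(1)]) (use x j 2(1) in \<open>auto simp: less_imp_le\<close>)
          then have "L k x > 0" using c[OF x(1)] False by (simp add: zero_less_mult_iff)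
          then show ?thesis using x by blast
        next
          assume "\<exists>p. (\<forall>i\<in>J. p i \<ge> 0) \<and> (\<exists>i\<in>J. p i > 0) \<and> (\<forall>x\<in>V. (\<Sum>i\<in>J. p i * L i x) = 0)"
          then obtain q where "\<forall>i\<in>J. q i \<ge> 0" "\<exists>i\<in>J. q i > 0" "\<forall>x\<in>V. (\<Sum>i\<in>J. q i * L i x) = 0"
            by blast
          then show ?thesis by (intro extend[of q 0]) auto
        qed
      qed
    qed
  qed
qed

section \<open>Calculus of the Rayleigh quotient on an open cone of a subspace\<close>

text \<open>The whole line through \<open>u\<close> in direction \<open>\<xi>\<close> stays in
  \<open>V\<close>, so differentiability within \<open>V\<close> determines the derivative along
  it.\<close>

lemma has_derivative_along_line:
  fixes f :: "'a::real_normed_vector \<Rightarrow> real"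
  assumes "(f has_derivative D) (at u within V)" "subspace V" "u \<in> V" "\<xi> \<in> V"
  shows "((\<lambda>t. f (u + t *\<^sub>R \<xi>)) has_real_derivative D \<xi>) (at 0)"
proof -
  have "((\<lambda>t. u + t *\<^sub>R \<xi>) has_derivative (\<lambda>t. t *\<^sub>R \<xi>)) (at (0::real))"
    by (auto intro!: derivative_eq_intros)
  moreover have "(f has_derivative D) (at (u + 0 *\<^sub>R \<xi>) within range (\<lambda>t. u + t *\<^sub>R \<xi>))"
    using assms by (auto intro!: has_derivative_subset[of f D _ V] simp: subspace_add subspace_scale)
  ultimately have "((\<lambda>t. f (u + t *\<^sub>R \<xi>)) has_derivative (\<lambda>t. D (t *\<^sub>R \<xi>))) (at 0)"
    by (rule has_derivative_in_compose)
  moreover have "(\<lambda>t. D (t *\<^sub>R \<xi>)) = (*) (D \<xi>)"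
    using has_derivative_linear[OF assms(1)] by (auto simp: linear_scale mult.commute)
  ultimately show ?thesis by (simp add: has_field_derivative_def)
qed

text \<open>One level of the scheme with the index dropped: \<open>V\<close> stands for
  \<open>W r\<close>, \<open>S\<close> for \<open>Sro r\<close>, and
  \<open>V \<inter> closure S\<close> for the closed cone \<open>Sr W Sro r\<close>.\<close>

locale discrete_cone =
  fixes A G :: "'w::real_normed_vector \<Rightarrow> 'w \<Rightarrow>\<^sub>L real" and V S :: "'w set"
  assumes subspace: "subspace V"
    and openin: "openin (top_of_set V) S"
    and G_pos: "u \<in> S \<Longrightarrow> v \<in> V \<inter> closure S - {0} \<Longrightarrow> G u v > 0"
    and C1_A: "v \<in> V \<Longrightarrow> C1_in_subspace V S (\<lambda>u. A u v)"
    and C1_G: "v \<in> V \<Longrightarrow> C1_in_subspace V S (\<lambda>u. G u v)"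
    and cont_A: "continuous_on UNIV A"
    and cont_G: "continuous_on UNIV G"
begin

lemma S_subset: "S \<subseteq> V"
  using openin openin_imp_subset by blast

lemma S_closure: "v \<in> S \<Longrightarrow> v \<in> V \<inter> closure S"
  using S_subset closure_subset by blast

lemma eventually_in_S:
  assumes "u \<in> S" "\<xi> \<in> V"
  shows "\<forall>\<^sub>F t::real in at 0. u + t *\<^sub>R \<xi> \<in> S"
proof -
  obtain T where T: "open T" "S = V \<inter> T"
    using openin openin_open by (metis Int_commute)
  have "((\<lambda>t::real. u + t *\<^sub>R \<xi>) \<longlongrightarrow> u + 0 *\<^sub>R \<xi>) (at 0)" by (intro tendsto_intros)
  then have "\<forall>\<^sub>F t::real in at 0. u + t *\<^sub>R \<xi> \<in> T"
    by (rule topological_tendstoD) (use T assms in auto)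
  then show ?thesis
    by (rule eventually_mono) (use T assms subspace in \<open>auto simp: subspace_add subspace_scale\<close>)
qed

text \<open>\<open>dir_deriv\<close> is built on \<open>deriv\<close>, which is informative only
  where a derivative exists; the \<open>C1_in_subspace\<close> assumption supplies
  existence.\<close>

lemma DERIV_dir:
  assumes "C1_in_subspace V S f" "u \<in> S" "\<xi> \<in> V"
  shows "((\<lambda>t. f (u + t *\<^sub>R \<xi>)) has_real_derivative dir_deriv f u \<xi>) (at 0)"
proof -
  obtain f' where "(f has_derivative f') (at u within V)"
    using assms unfolding C1_in_subspace_def by blast
  from has_derivative_along_line[OF this subspace _ assms(3)]
  have "((\<lambda>t. f (u + t *\<^sub>R \<xi>)) has_real_derivative f' \<xi>) (at 0)"
    using assms(2) S_subset by blast
  then show ?thesis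
    unfolding dir_deriv_def by (simp add: DERIV_imp_deriv)
qed

lemma DERIV_eqF:
  assumes "u \<in> S" "\<xi> \<in> V" "v \<in> V"
  shows "((\<lambda>t. eqF A G (u + t *\<^sub>R \<xi>) \<mu> v) has_real_derivative DeqF_discr A G u \<mu> \<xi> v) (at 0)"
    and "DeqF_discr A G u \<mu> \<xi> v = dir_deriv (\<lambda>w. A w v) u \<xi> - \<mu> * dir_deriv (\<lambda>w. G w v) u \<xi>"
proof -
  note D = DERIV_dir[OF C1_A[OF assms(3)] assms(1,2)] DERIV_dir[OF C1_G[OF assms(3)] assms(1,2)]
  have *: "((\<lambda>t. eqF A G (u + t *\<^sub>R \<xi>) \<mu> v) has_real_derivative
      dir_deriv (\<lambda>w. A w v) u \<xi> - \<mu> * dir_deriv (\<lambda>w. G w v) u \<xi>) (at 0)"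
    unfolding eqF_def by (auto simp: blinfun.bilinear_simps intro!: derivative_eq_intros D)
  show eq: "DeqF_discr A G u \<mu> \<xi> v = dir_deriv (\<lambda>w. A w v) u \<xi> - \<mu> * dir_deriv (\<lambda>w. G w v) u \<xi>"
    unfolding DeqF_discr_def by (subst dir_deriv_def) (rule DERIV_imp_deriv[OF *])
  show "((\<lambda>t. eqF A G (u + t *\<^sub>R \<xi>) \<mu> v) has_real_derivative DeqF_discr A G u \<mu> \<xi> v) (at 0)"
    using * unfolding eq .
qed

text \<open>For each \<open>w\<close> the functional \<open>eqF A G w \<mu>\<close> is linear, and
  differentiation in \<open>w\<close> commutes with finite sums.\<close>

lemma DeqF_discr_sum:
  assumes "u \<in> S" "\<xi> \<in> V" "\<And>i. i \<in> J \<Longrightarrow> \<eta> i \<in> V"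
  shows "DeqF_discr A G u \<mu> \<xi> (\<Sum>i\<in>J. p i *\<^sub>R \<eta> i) = (\<Sum>i\<in>J. p i * DeqF_discr A G u \<mu> \<xi> (\<eta> i))"
proof -
  have "((\<lambda>t. \<Sum>i\<in>J. p i * eqF A G (u + t *\<^sub>R \<xi>) \<mu> (\<eta> i)) has_real_derivative
      (\<Sum>i\<in>J. p i * DeqF_discr A G u \<mu> \<xi> (\<eta> i))) (at 0)"
    using assms by (intro DERIV_sum DERIV_cmult DERIV_eqF) auto
  then show ?thesis
    by (subst DeqF_discr_def, subst dir_deriv_def, intro DERIV_imp_deriv)
      (simp add: blinfun.bilinear_simps sum_distrib_left)
qed

lemma DeqF_discr_scale:
  assumes "u \<in> S" "\<xi> \<in> V" "v \<in> V"
  shows "DeqF_discr A G u \<mu> \<xi> (c *\<^sub>R v) = c * DeqF_discr A G u \<mu> \<xi> v"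
  using DeqF_discr_sum[where J = "{()}" and \<eta> = "\<lambda>_. v" and p = "\<lambda>_. c"] assms by simp

text \<open>Gordan's alternative asks for functionals linear on the whole space, while
  \<open>DeqF_discr\<close> is controlled only for directions in \<open>V\<close>. The derivatives
  within \<open>V\<close> provide a linear map \<open>D\<close> that agrees with it there.\<close>

lemma DeqF_discr_linear:
  assumes "u \<in> S" "v \<in> V"
  obtains D where "linear D" "\<And>\<xi>. \<xi> \<in> V \<Longrightarrow> DeqF_discr A G u \<mu> \<xi> v = D \<xi>"
proof -
  obtain a where a: "((\<lambda>u. A u v) has_derivative blinfun_apply a) (at u within V)"
    using C1_A[OF assms(2)] assms(1) unfolding C1_in_subspace_def by blast
  obtain g where g: "((\<lambda>u. G u v) has_derivative blinfun_apply g) (at u within V)"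
    using C1_G[OF assms(2)] assms(1) unfolding C1_in_subspace_def by blast
  have "blinfun_apply (a - \<mu> *\<^sub>R g) = (\<lambda>\<xi>. a \<xi> - \<mu> * g \<xi>)"
    by (simp add: blinfun.bilinear_simps fun_eq_iff)
  then have "((\<lambda>w. eqF A G w \<mu> v) has_derivative blinfun_apply (a - \<mu> *\<^sub>R g)) (at u within V)"
    using has_derivative_diff[OF a has_derivative_mult_right[OF g, of \<mu>]]
    by (simp add: eqF_def blinfun.bilinear_simps )
  from has_derivative_along_line[OF this subspace]
  have "DeqF_discr A G u \<mu> \<xi> v = (a - \<mu> *\<^sub>R g) \<xi>" if "\<xi> \<in> V" for \<xi>
    unfolding DeqF_discr_def dir_deriv_def
    by (intro DERIV_imp_deriv) (use that assms S_subset in blast)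
  moreover have "linear (blinfun_apply (a - \<mu> *\<^sub>R g))"
    by (rule bounded_linear.linear) (rule blinfun.bounded_linear_right)
  ultimately show ?thesis by (rule that[rotated])
qed

text \<open>Positivity of \<open>G u v\<close> clears the denominator, so that statements about the
  quotient become statements about a functional linear in \<open>v\<close>.\<close>

lemma eqF_eq_0_iff:
  assumes "u \<in> S" "v \<in> V \<inter> closure S - {0}"
  shows "eqF A G u \<mu> v = 0 \<longleftrightarrow> rayleigh A G u v = \<mu>"
  using G_pos[OF assms] by (auto simp: eqF_def rayleigh_def blinfun.bilinear_simps field_simps)

lemma le_rayleigh_iff:
  assumes "u \<in> S" "v \<in> V \<inter> closure S - {0}"
  shows "\<mu> \<le> rayleigh A G u v \<longleftrightarrow> 0 \<le> eqF A G u \<mu> v"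
  using G_pos[OF assms] by (auto simp: eqF_def rayleigh_def blinfun.bilinear_simps field_simps)

text \<open>Quotient rule: with \<open>A u v = \<mu> * G u v\<close>, one factor
  \<open>G u v\<close> cancels. Criticality in \<open>u\<close> is thus the adjoint equation for
  \<open>v\<close>.\<close>

lemma Du_rayleigh_eq:
  assumes "u \<in> S" "\<xi> \<in> V" "v \<in> V \<inter> closure S - {0}" "rayleigh A G u v = \<mu>"
  shows "Du_rayleigh A G u v \<xi> = DeqF_discr A G u \<mu> \<xi> v / G u v"
proof -
  have v: "v \<in> V" using assms by blast
  have g: "G u v > 0" using G_pos assms by blast
  have "((\<lambda>t. rayleigh A G (u + t *\<^sub>R \<xi>) v) has_real_derivative
      (dir_deriv (\<lambda>w. A w v) u \<xi> * G u v - A u v * dir_deriv (\<lambda>w. G w v) u \<xi>) / (G u v * G u v)) (at 0)"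
    unfolding rayleigh_def
    using DERIV_divide[OF DERIV_dir[OF C1_A[OF v] assms(1,2)] DERIV_dir[OF C1_G[OF v] assms(1,2)]] g
    by simp
  then have "Du_rayleigh A G u v \<xi> =
      (dir_deriv (\<lambda>w. A w v) u \<xi> * G u v - A u v * dir_deriv (\<lambda>w. G w v) u \<xi>) / (G u v * G u v)"
    unfolding Du_rayleigh_def by (subst dir_deriv_def) (rule DERIV_imp_deriv)
  also have "\<dots> = DeqF_discr A G u \<mu> \<xi> v / G u v"
    using g assms(4) by (simp add: DERIV_eqF(2)[OF assms(1,2) v] rayleigh_def field_simps)
  finally show ?thesis .
qed

text \<open>If \<open>eqF\<close> vanishes on \<open>V\<close>, the quotient equals
  \<open>\<mu>\<close> wherever its denominator is positive, hence on a neighbourhood of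
  \<open>t = 0\<close> along the line.\<close>

lemma Dv_rayleigh_eq_0:
  assumes "u \<in> S" "\<zeta> \<in> V" "v \<in> V \<inter> closure S - {0}" "\<forall>\<zeta>\<in>V. eqF A G u \<mu> \<zeta> = 0"
  shows "Dv_rayleigh A G u v \<zeta> = 0"
proof -
  have g: "G u v > 0" using G_pos assms by blast
  have "((\<lambda>t::real. G u (v + t *\<^sub>R \<zeta>)) \<longlongrightarrow> G u (v + 0 *\<^sub>R \<zeta>)) (nhds 0)"
    by (intro tendsto_intros filterlim_ident)
  then have "\<forall>\<^sub>F t::real in nhds 0. G u (v + t *\<^sub>R \<zeta>) > 0"
    by (rule order_tendstoD(1)) (use g in simp)
  then have "\<forall>\<^sub>F t::real in nhds 0. rayleigh A G u (v + t *\<^sub>R \<zeta>) = \<mu>"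
  proof eventually_elim
    case (elim t)
    have "v + t *\<^sub>R \<zeta> \<in> V" using assms subspace by (simp add: subspace_add subspace_scale)
    then have "eqF A G u \<mu> (v + t *\<^sub>R \<zeta>) = 0" using assms(4) by blast
    with elim show ?case by (simp add: rayleigh_def eqF_def blinfun.diff_left blinfun.scaleR_left)
  qed
  then have "((\<lambda>t. rayleigh A G u (v + t *\<^sub>R \<zeta>)) has_real_derivative 0) (at 0)"
    by (subst DERIV_cong_ev[OF refl _ refl, where g = "\<lambda>_. \<mu>"]) auto
  then show ?thesis
    unfolding Dv_rayleigh_def dir_deriv_def by (rule DERIV_imp_deriv)
qed

text \<open>Each point of the punctured closed cone is a limit of points of \<open>S\<close>, and
  the quotient is continuous in \<open>v\<close> there. With \<open>0 \<notin> S\<close> the open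
  cone lies in the punctured closed one.\<close>

lemma INF_closure_cone:
  assumes "u \<in> S" "0 \<notin> S"
  shows "(INF v\<in>V \<inter> closure S - {0}. ereal (rayleigh A G u v)) = (INF v\<in>S. ereal (rayleigh A G u v))"
proof (rule antisym)
  show "(INF v\<in>V \<inter> closure S - {0}. ereal (rayleigh A G u v)) \<le> (INF v\<in>S. ereal (rayleigh A G u v))"
    by (rule INF_superset_mono) (use S_closure assms in auto)
  show "(INF v\<in>S. ereal (rayleigh A G u v)) \<le> (INF v\<in>V \<inter> closure S - {0}. ereal (rayleigh A G u v))"
  proof (rule INF_greatest)
    fix v assume v: "v \<in> V \<inter> closure S - {0}"
    then obtain x where x: "\<And>n. x n \<in> S" "x \<longlonglongrightarrow> v" using closure_sequential by blast
    have "(\<lambda>n. ereal (rayleigh A G u (x n))) \<longlonglongrightarrow> ereal (rayleigh A G u v)"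
      unfolding rayleigh_def using G_pos[OF assms(1) v]
      by (intro tendsto_intros x) auto
    then show "(INF v\<in>S. ereal (rayleigh A G u v)) \<le> ereal (rayleigh A G u v)"
      by (rule LIMSEQ_le_const) (use x in \<open>auto intro: INF_lower\<close>)
  qed
qed

lemma le_INF_rayleigh:
  assumes "u \<in> S" "\<And>v. v \<in> S \<Longrightarrow> 0 \<le> eqF A G u \<mu> v"
  shows "ereal \<mu> \<le> (INF v\<in>V \<inter> closure S - {0}. ereal (rayleigh A G u v))"
proof (rule INF_greatest)
  fix v assume v: "v \<in> V \<inter> closure S - {0}"
  then obtain x where x: "\<And>n. x n \<in> S" "x \<longlonglongrightarrow> v" using closure_sequential by blast
  have "(\<lambda>n. eqF A G u \<mu> (x n)) \<longlonglongrightarrow> eqF A G u \<mu> v"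
    by (intro tendsto_intros x)
  then have "0 \<le> eqF A G u \<mu> v" by (rule LIMSEQ_le_const) (use x assms in auto)
  then show "ereal \<mu> \<le> ereal (rayleigh A G u v)" using le_rayleigh_iff[OF assms(1) v] by simp
qed

text \<open>An infimum of continuous functions of \<open>u\<close> is upper semicontinuous, and a
  maximizing sequence eventually stays in the superlevel set of \<open>\<alpha>\<close>, whose
  closure is compact and inside \<open>S\<close>.\<close>

lemma INF_rayleigh_attains_sup:
  defines "\<Lambda> \<equiv> \<lambda>u. INF v\<in>V \<inter> closure S - {0}. ereal (rayleigh A G u v)"
  assumes "ereal \<alpha> < (SUP u\<in>S. \<Lambda> u)"
    and "compact (V \<inter> closure {u\<in>S. ereal \<alpha> \<le> \<Lambda> u})"
    and "V \<inter> closure {u\<in>S. ereal \<alpha> \<le> \<Lambda> u} \<subseteq> S"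
  obtains u where "u \<in> S" "\<Lambda> u = (SUP u\<in>S. \<Lambda> u)"
proof -
  let ?K = "{u\<in>S. ereal \<alpha> \<le> \<Lambda> u}"
  have ne: "S \<noteq> {}" using assms(2) by auto
  obtain f where f: "range f \<subseteq> \<Lambda> ` S" "incseq f" "f \<longlonglongrightarrow> (SUP u\<in>S. \<Lambda> u)"
    using Sup_countable_SUP[of "\<Lambda> ` S"] ne LIMSEQ_SUP by (metis image_is_empty)
  have "\<forall>n. \<exists>u\<in>S. f n = \<Lambda> u" using f(1) by blast
  then obtain x where x: "\<And>n. x n \<in> S" "\<And>n. f n = \<Lambda> (x n)" by metis
  have "\<forall>\<^sub>F n in sequentially. ereal \<alpha> < f n" using order_tendstoD(1)[OF f(3) assms(2)] .
  then obtain m where m: "\<And>n. n \<ge> m \<Longrightarrow> ereal \<alpha> < f n" by (auto simp: eventually_sequentially)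
  have xK: "x (n + m) \<in> V \<inter> closure ?K" for n
  proof -
    have "ereal \<alpha> \<le> \<Lambda> (x (n + m))"
      using m[of "n + m", OF le_add2] unfolding x(2) by (rule less_imp_le)
    then have "x (n + m) \<in> ?K" by (intro CollectI conjI x(1))
    then have "x (n + m) \<in> closure ?K" using closure_subset by (rule rev_subsetD)
    then show ?thesis using x(1) S_subset by (intro IntI) auto
  qed
  obtain u \<sigma> where u: "u \<in> V \<inter> closure ?K" "strict_mono \<sigma>" "((\<lambda>n. x (n + m)) \<circ> \<sigma>) \<longlonglongrightarrow> u"
    using seq_compactE[OF compact_imp_seq_compact[OF assms(3)], of "\<lambda>n. x (n + m)", OF allI[OF xK]] by metis
  let ?y = "\<lambda>n. x (\<sigma> n + m)"
  have y: "?y \<longlonglongrightarrow> u" using u(3) by (simp add: o_def)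
  have uS: "u \<in> S" using u assms(4) by blast
  have fy: "(\<lambda>n. f (\<sigma> n + m)) \<longlonglongrightarrow> (SUP u\<in>S. \<Lambda> u)"
    using LIMSEQ_subseq_LIMSEQ[OF LIMSEQ_ignore_initial_segment[OF f(3), of m] u(2)] by (simp add: o_def)
  \<comment> \<open>Upper semicontinuity at the limit: for fixed \<open>v\<close> the values
    \<open>f\<close> lie below the quotients at \<open>?y n\<close>, and both sides
    converge.\<close>
  have "(SUP u\<in>S. \<Lambda> u) \<le> \<Lambda> u"
    unfolding \<Lambda>_def
  proof (rule INF_greatest)
    fix v assume v: "v \<in> V \<inter> closure S - {0}"
    have "(\<lambda>n. A (?y n)) \<longlonglongrightarrow> A u" "(\<lambda>n. G (?y n)) \<longlonglongrightarrow> G u"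
      using cont_A cont_G y by (auto simp: continuous_on_eq_continuous_at intro: isCont_tendsto_compose)
    then have "(\<lambda>n. ereal (rayleigh A G (?y n) v)) \<longlonglongrightarrow> ereal (rayleigh A G u v)"
      unfolding rayleigh_def using G_pos[OF uS v] by (intro tendsto_intros) auto
    moreover have "f (\<sigma> n + m) \<le> ereal (rayleigh A G (?y n) v)" for n
      unfolding x \<Lambda>_def by (rule INF_lower[OF v])
    ultimately show "(SUP u\<in>S. INF v\<in>V \<inter> closure S - {0}. ereal (rayleigh A G u v)) \<le> ereal (rayleigh A G u v)"
      using fy unfolding \<Lambda>_def by (meson LIMSEQ_le)
  qed
  with uS have "\<Lambda> u = (SUP u\<in>S. \<Lambda> u)" by (simp add: SUP_upper antisym)
  with uS show ?thesis by (rule that)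
qed

end

section \<open>Open orthants in the coordinates of a basis\<close>

locale orthant_cone = discrete_cone A G V S
  for A G :: "'w::real_normed_vector \<Rightarrow> 'w \<Rightarrow>\<^sub>L real" and V S :: "'w set" +
  fixes \<eta> :: "'i \<Rightarrow> 'w" and J :: "'i set"
  assumes finite_J: "finite J"
    and inj: "inj_on \<eta> J"
    and indep: "independent (\<eta> ` J)"
    and span: "span (\<eta> ` J) = V"
    and S_eq: "S = {\<Sum>i\<in>J. a i *\<^sub>R \<eta> i | a. \<forall>i\<in>J. a i > 0}"
begin

lemma \<eta>_in_V: "i \<in> J \<Longrightarrow> \<eta> i \<in> V"
  unfolding span[symmetric] by (intro span_base imageI)

text \<open>\<open>independent\<close> concerns the set of basis vectors; injectivity of
  \<open>\<eta>\<close> lets the coefficients be read off that set through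
  \<open>inv_into\<close>.\<close>

lemma combination_eq_0:
  assumes "(\<Sum>i\<in>J. p i *\<^sub>R \<eta> i) = 0" "i \<in> J"
  shows "p i = 0"
proof -
  define q where "q v = p (inv_into J \<eta> v)" for v
  have q: "q (\<eta> j) = p j" if "j \<in> J" for j
    unfolding q_def using inv_into_f_f[OF inj that] by simp
  have "(\<Sum>v\<in>\<eta> ` J. q v *\<^sub>R v) = (\<Sum>i\<in>J. q (\<eta> i) *\<^sub>R \<eta> i)"
    using inj by (simp only: sum.reindex o_def)
  also have "\<dots> = (\<Sum>i\<in>J. p i *\<^sub>R \<eta> i)"
    by (rule sum.cong) (simp_all add: q)
  also note assms(1)
  finally have "q (\<eta> i) = 0"
    by (rule independentD[OF indep finite_imageI[OF finite_J] subset_refl]) (use assms(2) in blast)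
  then show ?thesis using q[OF assms(2)] by simp
qed

lemma nonneg_combination:
  assumes "\<forall>i\<in>J. p i \<ge> 0" "\<exists>i\<in>J. p i > 0"
  shows "(\<Sum>i\<in>J. p i *\<^sub>R \<eta> i) \<in> V \<inter> closure S - {0}"
proof -
  \<comment> \<open>Adding \<open>1/(n+1)\<close> to every coefficient moves the vector into the
    open orthant.\<close>
  define x where "x n = (\<Sum>i\<in>J. (p i + inverse (real (Suc n))) *\<^sub>R \<eta> i)" for n
  have "x \<longlonglongrightarrow> (\<Sum>i\<in>J. (p i + 0) *\<^sub>R \<eta> i)"
    unfolding x_def by (intro tendsto_intros LIMSEQ_inverse_real_of_nat)
  moreover have "x n \<in> S" for n
  proof -
    have "\<forall>i\<in>J. p i + inverse (real (Suc n)) > 0"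
      using assms(1) by (intro ballI add_nonneg_pos) simp_all
    then show ?thesis
      unfolding S_eq x_def by (intro CollectI exI[of _ "\<lambda>i. p i + inverse (real (Suc n))"] conjI refl)
  qed
  ultimately have "(\<Sum>i\<in>J. (p i + 0) *\<^sub>R \<eta> i) \<in> closure S"
    unfolding closure_sequential by (intro exI[of _ x] conjI allI)
  then have "(\<Sum>i\<in>J. p i *\<^sub>R \<eta> i) \<in> closure S" by simp
  moreover have "(\<Sum>i\<in>J. p i *\<^sub>R \<eta> i) \<in> V"
    by (intro subspace_sum[OF subspace] subspace_scale[OF subspace] \<eta>_in_V)
  moreover have "(\<Sum>i\<in>J. p i *\<^sub>R \<eta> i) \<noteq> 0"
  proof
    assume "(\<Sum>i\<in>J. p i *\<^sub>R \<eta> i) = 0"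
    then have "\<forall>i\<in>J. p i = 0" using combination_eq_0 by blast
    with assms(2) show False by auto
  qed
  ultimately show ?thesis by blast
qed

lemma basis_in_closed_cone:
  assumes "i \<in> J"
  shows "\<eta> i \<in> V \<inter> closure S - {0}"
proof -
  have "(\<Sum>j\<in>J. (if j = i then 1 else 0) *\<^sub>R \<eta> j) = \<eta> i"
    using assms finite_J by (simp add: if_distrib[of "\<lambda>c. c *\<^sub>R _"] cong: if_cong)
  moreover have "(\<Sum>j\<in>J. (if j = i then 1 else 0) *\<^sub>R \<eta> j) \<in> V \<inter> closure S - {0}"
    by (rule nonneg_combination) (use assms in auto)
  ultimately show ?thesis by simp
qed

lemma closed_cone_trivial:
  assumes "J = {}"
  shows "V \<inter> closure S - {0} = {}"
  unfolding span[symmetric] assms by simp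

text \<open>The degenerate level: by independence only the empty basis gives
  \<open>0 \<in> S\<close>. Infima over the punctured cone are then infinite, which a finite level
  rules out.\<close>

lemma zero_in_S_imp:
  assumes "0 \<in> S"
  shows "V \<inter> closure S - {0} = {}"
proof -
  from assms obtain a where "(\<Sum>i\<in>J. a i *\<^sub>R \<eta> i) = 0" "\<forall>i\<in>J. a i > 0"
    unfolding S_eq by auto
  then have "a i = 0" "a i > 0" if "i \<in> J" for i
    using that by (auto intro: combination_eq_0)
  then have "J = {}" by force
  then show ?thesis by (rule closed_cone_trivial)
qed

text \<open>
  If no direction increases all active quotients at a maximizer, Gordan's alternative yields a
  nonnegative multiplier vector. Once the multiplier is interior, all quotients are active.
\<close>

lemma maximizer_multiplier:
  assumes u: "u \<in> S"
    and attained: "(INF v\<in>V \<inter> closure S - {0}. ereal (rayleigh A G u v)) = ereal l"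
    and maximal: "\<And>w. w \<in> S \<Longrightarrow> (INF v\<in>V \<inter> closure S - {0}. ereal (rayleigh A G w v)) \<le> ereal l"
    and interior: "\<And>v. \<lbrakk>v \<in> V \<inter> closure S - {0}; rayleigh A G u v = l;
        \<forall>\<xi>\<in>V. Du_rayleigh A G u v \<xi> = 0\<rbrakk> \<Longrightarrow> v \<in> S"
  obtains v where "v \<in> S" "\<forall>\<zeta>\<in>V. eqF A G u l \<zeta> = 0" "\<forall>\<xi>\<in>V. DeqF_discr A G u l \<xi> v = 0"
proof -
  have ne: "J \<noteq> {}"
  proof
    assume "J = {}"
    then show False using attained unfolding closed_cone_trivial[OF \<open>J = {}\<close>] by (simp add: top_ereal_def)
  qed
  let ?F = "\<lambda>i w. eqF A G w l (\<eta> i)"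
  have F_nonneg: "?F i u \<ge> 0" if "i \<in> J" for i
  proof -
    have "ereal l \<le> ereal (rayleigh A G u (\<eta> i))"
      unfolding attained[symmetric] by (rule INF_lower[OF basis_in_closed_cone[OF that]])
    then show ?thesis using le_rayleigh_iff[OF u basis_in_closed_cone[OF that]] by simp
  qed
  \<comment> \<open>The active indices, at which the quotient of the basis vector equals
    \<open>l\<close>; \<open>F_nonneg\<close> makes the values at all other indices
    positive.\<close>
  define J0 where "J0 = {i\<in>J. ?F i u = 0}"
  have J0: "finite J0" "J0 \<subseteq> J" using finite_J by (auto simp: J0_def)
  have "\<forall>i\<in>J. \<exists>D. linear D \<and> (\<forall>\<xi>\<in>V. DeqF_discr A G u l \<xi> (\<eta> i) = D \<xi>)"
    using DeqF_discr_linear[OF u \<eta>_in_V] by metis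
  then obtain D where D: "\<And>i. i \<in> J \<Longrightarrow> linear (D i)"
      "\<And>i \<xi>. i \<in> J \<Longrightarrow> \<xi> \<in> V \<Longrightarrow> DeqF_discr A G u l \<xi> (\<eta> i) = D i \<xi>"
    by metis
  have no_ascent: False if \<xi>: "\<xi> \<in> V" "\<forall>i\<in>J0. D i \<xi> > 0" for \<xi>
  proof -
    have "\<forall>\<^sub>F t in at_right (0::real). ?F i (u + t *\<^sub>R \<xi>) > 0" if i: "i \<in> J" for i
    proof -
      have deriv: "((\<lambda>t. ?F i (u + t *\<^sub>R \<xi>)) has_real_derivative D i \<xi>) (at 0)"
        using DERIV_eqF(1)[OF u \<xi>(1) \<eta>_in_V[OF i], of l] D(2)[OF i \<xi>(1)] by simp
      show ?thesis
      \<comment> \<open>An active value starts at 0 with positive derivative; an inactive one is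
        positive and stays so by continuity. This also covers empty \<open>J0\<close>.\<close>
      proof (cases "i \<in> J0")
        case True
        from DERIV_pos_inc_right[OF deriv] obtain d where
          "d > 0" "\<forall>h>0. h < d \<longrightarrow> ?F i (u + 0 *\<^sub>R \<xi>) < ?F i (u + (0 + h) *\<^sub>R \<xi>)"
          using \<xi>(2) True by blast
        then show ?thesis
          using True by (auto simp: J0_def eventually_at_right_field)
      next
        case False
        then have "?F i u > 0" using F_nonneg[OF i] i by (simp add: J0_def)
        moreover have "((\<lambda>t. ?F i (u + t *\<^sub>R \<xi>)) \<longlongrightarrow> ?F i (u + 0 *\<^sub>R \<xi>)) (at_right 0)"
          using DERIV_isCont[OF deriv] unfolding isCont_def by (rule filterlim_mono) (auto simp: at_le)
        ultimately show ?thesis by (intro order_tendstoD(1)[where a = 0]) auto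
      qed
    qed
    then have "\<forall>\<^sub>F t in at_right (0::real). \<forall>i\<in>J. ?F i (u + t *\<^sub>R \<xi>) > 0"
      using finite_J by (simp add: eventually_ball_finite)
    moreover have "\<forall>\<^sub>F t in at_right (0::real). u + t *\<^sub>R \<xi> \<in> S"
      using eventually_in_S[OF u \<xi>(1)] by (rule filter_leD[rotated]) (simp add: at_le)
    ultimately have "\<forall>\<^sub>F t in at_right (0::real). (\<forall>i\<in>J. ?F i (u + t *\<^sub>R \<xi>) > 0) \<and> u + t *\<^sub>R \<xi> \<in> S"
      by (rule eventually_conj)
    then obtain w where w: "\<forall>i\<in>J. ?F i w > 0" "w \<in> S"
      using eventually_happens'[OF trivial_limit_at_right_real] by blast
    \<comment> \<open>The terms are the excesses of the quotients at \<open>\<eta> i\<close> over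
      \<open>l\<close>, so \<open>c\<close> is a uniform gain: the infimum at \<open>w\<close> is at
      least \<open>l + c\<close>, against maximality.\<close>
    define c where "c = Min ((\<lambda>i. ?F i w / G w (\<eta> i)) ` J)"
    have Gw: "G w (\<eta> i) > 0" if "i \<in> J" for i
      using G_pos[OF w(2) basis_in_closed_cone[OF that]] .
    have "c > 0"
      unfolding c_def using w(1) Gw ne finite_J by (subst Min_gr_iff) auto
    have "ereal (l + c) \<le> (INF v\<in>V \<inter> closure S - {0}. ereal (rayleigh A G w v))"
    proof (rule le_INF_rayleigh[OF w(2)])
      fix v assume "v \<in> S"
      then obtain a where a: "v = (\<Sum>i\<in>J. a i *\<^sub>R \<eta> i)" "\<forall>i\<in>J. a i > 0" unfolding S_eq by blast
      have c_le: "c \<le> ?F i w / G w (\<eta> i)" if "i \<in> J" for i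
        unfolding c_def using finite_J that by simp
      have "c * G w (\<eta> i) \<le> ?F i w" if "i \<in> J" for i
        using c_le[OF that] by (simp only: pos_le_divide_eq[OF Gw[OF that]])
      note cG_le = this
      have "0 \<le> eqF A G w (l + c) (\<eta> i)" if "i \<in> J" for i
        using cG_le[OF that] by (simp add: eqF_def blinfun.diff_left blinfun.scaleR_left ring_distribs)
      then have "0 \<le> (\<Sum>i\<in>J. a i * eqF A G w (l + c) (\<eta> i))"
        using a(2) by (intro sum_nonneg mult_nonneg_nonneg) (auto intro: less_imp_le)
      then show "0 \<le> eqF A G w (l + c) v"
        unfolding a(1) by (simp add: blinfun.sum_right blinfun.scaleR_right)
    qed
    with maximal[OF w(2)] have "ereal (l + c) \<le> ereal l" by (rule order_trans[rotated])
    with \<open>c > 0\<close> show False by simp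
  qed
  from gordan_alternative[OF J0(1), of D V] no_ascent obtain p where
    p: "\<forall>i\<in>J0. p i \<ge> 0" "\<exists>i\<in>J0. p i > 0" "\<forall>\<xi>\<in>V. (\<Sum>i\<in>J0. p i * D i \<xi>) = 0"
    using D(1) J0(2) subspace by blast
  \<comment> \<open>The multiplier extended by 0 to inactive indices; hence
    \<open>eqF A G u l\<close> vanishes at the resulting vector \<open>v\<close>.\<close>
  define q where "q i = (if i \<in> J0 then p i else 0)" for i
  define v where "v = (\<Sum>i\<in>J. q i *\<^sub>R \<eta> i)"
  have q_sum: "(\<Sum>i\<in>J. q i * f i) = (\<Sum>i\<in>J0. p i * f i)" for f :: "'i \<Rightarrow> real"
    using J0 finite_J by (intro sum.mono_neutral_cong_right) (auto simp: q_def)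
  have v_cone: "v \<in> V \<inter> closure S - {0}"
    unfolding v_def using p J0 by (intro nonneg_combination) (auto simp: q_def)
  have "eqF A G u l v = (\<Sum>i\<in>J. q i * ?F i u)"
    by (simp add: v_def blinfun.sum_right blinfun.scaleR_right)
  then have Fv: "eqF A G u l v = 0"
    unfolding q_sum by (simp add: J0_def)
  then have ray: "rayleigh A G u v = l" using eqF_eq_0_iff[OF u v_cone] by simp
  have Dv: "DeqF_discr A G u l \<xi> v = 0" if "\<xi> \<in> V" for \<xi>
  proof -
    have "DeqF_discr A G u l \<xi> v = (\<Sum>i\<in>J. q i * D i \<xi>)"
      unfolding v_def using u that \<eta>_in_V D(2) by (simp add: DeqF_discr_sum)
    then show ?thesis using p(3) that by (simp add: q_sum)
  qed
  have vS: "v \<in> S"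
    by (rule interior[OF v_cone ray]) (simp add: Du_rayleigh_eq[OF u _ v_cone ray] Dv)
  \<comment> \<open>As a point of \<open>S\<close>, \<open>v\<close> has all coefficients positive.
    The nonnegative values \<open>?F i u\<close> with these weights sum to 0, so each vanishes and
    every index is active.\<close>
  then obtain a where a: "v = (\<Sum>i\<in>J. a i *\<^sub>R \<eta> i)" "\<forall>i\<in>J. a i > 0" unfolding S_eq by blast
  have "(\<Sum>i\<in>J. a i * ?F i u) = 0"
    using Fv by (simp add: a(1) blinfun.sum_right blinfun.scaleR_right)
  then have "\<forall>i\<in>J. a i * ?F i u = 0"
    using a(2) F_nonneg finite_J by (subst (asm) sum_nonneg_eq_0_iff) (auto intro: less_imp_le)
  then have F0: "\<forall>i\<in>J. ?F i u = 0" using a(2) by fastforce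
  have "eqF A G u l \<zeta> = 0" if "\<zeta> \<in> V" for \<zeta>
    by (rule linear_eq_0_on_span[of "eqF A G u l" "\<eta> ` J"])
      (use F0 that span in \<open>auto intro: bounded_linear.linear blinfun.bounded_linear_right\<close>)
  with vS Dv show ?thesis by (intro that) auto
qed

end

section \<open>Saddle pairs at a fixed level of the scheme\<close>

lemma Sr_eq:
  assumes "Sro r \<subseteq> W r"
  shows "Sr W Sro r = W r \<inter> closure (Sro r)"
  unfolding Sr_def using assms by (simp add: closure_of_subtopology Int_absorb1)

lemma galerkin_orthant_cone:
  assumes "basic_setting jW jC So Uo A G" "galerkin_spaces W I" "cond_C jW jC So Uo W Sro I"
    "cond_CQ A G W Sro" "r \<ge> 1"
  obtains \<eta> :: "nat \<Rightarrow> 'w::banach" where "orthant_cone A G (W r) (Sro r) \<eta> {1..dim (W r)}"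
    and "Sr W Sro r = W r \<inter> closure (Sro r)"
proof -
  note C = assms(3)[unfolded cond_C_def]
  note C1 = C[THEN conjunct1, rule_format, OF assms(5)]
  have Sr: "Sr W Sro r = W r \<inter> closure (Sro r)"
    by (rule Sr_eq) (rule C1[THEN conjunct1])
  note C2 = C[THEN conjunct2, THEN conjunct1, rule_format, OF assms(5)]
  obtain \<eta> :: "nat \<Rightarrow> 'w" where \<eta>:
    "inj_on \<eta> {1..dim (W r)}" "independent (\<eta> ` {1..dim (W r)})" "span (\<eta> ` {1..dim (W r)}) = W r"
    "Sro r = {\<Sum>i=1..dim (W r). v i *\<^sub>R \<eta> i | v. \<forall>i\<in>{1..dim (W r)}. v i > 0}"
    using C2 by (elim exE conjE) (rule that)
  note CQ = assms(4)[unfolded cond_CQ_def, THEN spec, THEN mp, OF assms(5), THEN conjunct1]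
    assms(4)[unfolded cond_CQ_def, THEN spec, THEN mp, OF assms(5), THEN conjunct2]
  have "orthant_cone A G (W r) (Sro r) \<eta> {1..dim (W r)}"
  proof
    show "subspace (W r)" using assms(2,5) unfolding galerkin_spaces_def by blast
    show "openin (top_of_set (W r)) (Sro r)" using C1 by blast
    show "G u v > 0" if "u \<in> Sro r" "v \<in> W r \<inter> closure (Sro r) - {0}" for u v
      using CQ(1)[THEN bspec, THEN bspec] that unfolding Sr by blast
    show "C1_in_subspace (W r) (Sro r) (\<lambda>u. A u v)" "C1_in_subspace (W r) (Sro r) (\<lambda>u. G u v)"
      if "v \<in> W r" for v
      using CQ(2) that by blast+
    show "continuous_on UNIV A" "continuous_on UNIV G"
      using assms(1) unfolding basic_setting_def by blast+
  qed (rule finite_atLeastAtMost \<eta>)+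
  from this Sr show ?thesis by (rule that)
qed

text \<open>The maximizer and its multiplier form the pair. The equation on \<open>W r\<close> makes
  the quotient at \<open>us\<close> constant on the cone, so minimality of \<open>vs\<close> is
  immediate.\<close>

lemma discrete_saddle_pair_exists:
  fixes A G :: "'w::banach \<Rightarrow> 'w \<Rightarrow>\<^sub>L real"
  assumes "basic_setting jW jC So Uo A G" "galerkin_spaces W I" "cond_C jW jC So Uo W Sro I"
    "cond_CQ A G W Sro" "r \<ge> 1"
    and bounds: "0 \<le> lam_star A G W Sro r" "lam_star A G W Sro r < \<infinity>"
    and compactness: "\<exists>\<alpha>::real. ereal \<alpha> < lam_star A G W Sro r \<and>
       (let K = {u \<in> Sro r. lam A G W Sro r u \<ge> ereal \<alpha>};
            clK = (top_of_set (W r)) closure_of K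
        in compact clK \<and> clK \<subseteq> Sro r)"
    and interior: "\<And>u v. \<lbrakk>u \<in> Sro r; v \<in> Sr W Sro r - {0};
       ereal (rayleigh A G u v) = lam_star A G W Sro r;
       \<forall>\<xi>\<in>W r. Du_rayleigh A G u v \<xi> = 0\<rbrakk> \<Longrightarrow> v \<in> Sro r"
  shows "\<exists>us vs. discrete_saddle_pair A G W Sro r us vs"
proof -
  obtain \<eta> :: "nat \<Rightarrow> 'w" where oc: "orthant_cone A G (W r) (Sro r) \<eta> {1..dim (W r)}"
    and Sr: "Sr W Sro r = W r \<inter> closure (Sro r)"
    using galerkin_orthant_cone[OF assms(1-5)] .
  interpret orthant_cone A G "W r" "Sro r" \<eta> "{1..dim (W r)}" by (rule oc)
  let ?\<Lambda> = "\<lambda>u. INF v\<in>W r \<inter> closure (Sro r) - {0}. ereal (rayleigh A G u v)"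
  have lam: "lam A G W Sro r = ?\<Lambda>" by (simp add: lam_def Sr fun_eq_iff)
  have star: "lam_star A G W Sro r = (SUP u\<in>Sro r. ?\<Lambda> u)" by (simp add: lam_star_def lam)
  \<comment> \<open>The two bounds exclude both infinite values of the level.\<close>
  obtain l where l: "lam_star A G W Sro r = ereal l"
    using bounds by (cases "lam_star A G W Sro r") auto
  obtain \<alpha> where \<alpha>: "ereal \<alpha> < lam_star A G W Sro r"
    and cl: "compact ((top_of_set (W r)) closure_of {u \<in> Sro r. ereal \<alpha> \<le> ?\<Lambda> u})"
      "(top_of_set (W r)) closure_of {u \<in> Sro r. ereal \<alpha> \<le> ?\<Lambda> u} \<subseteq> Sro r"
    using compactness unfolding Let_def lam by blast
  have "{u \<in> Sro r. ereal \<alpha> \<le> ?\<Lambda> u} \<subseteq> W r" using S_subset by blast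
  then have "(top_of_set (W r)) closure_of {u \<in> Sro r. ereal \<alpha> \<le> ?\<Lambda> u} =
      W r \<inter> closure {u \<in> Sro r. ereal \<alpha> \<le> ?\<Lambda> u}"
    by (simp add: closure_of_subtopology Int_absorb1)
  note cl = cl[unfolded this]
  obtain us where us: "us \<in> Sro r" "?\<Lambda> us = (SUP u\<in>Sro r. ?\<Lambda> u)"
    using INF_rayleigh_attains_sup[OF \<alpha>[unfolded star] cl] .
  have attained: "?\<Lambda> us = ereal l" using us(2) l star by simp
  have maximal: "?\<Lambda> w \<le> ereal l" if "w \<in> Sro r" for w
    unfolding l[symmetric] star using that by (rule SUP_upper)
  have int: "v \<in> Sro r" if "v \<in> W r \<inter> closure (Sro r) - {0}" "rayleigh A G us v = l"
      "\<forall>\<xi>\<in>W r. Du_rayleigh A G us v \<xi> = 0" for v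
    by (rule interior[OF us(1) _ _ that(3)]) (use that l Sr in simp_all)
  obtain vs where vs: "vs \<in> Sro r" "\<forall>\<zeta>\<in>W r. eqF A G us l \<zeta> = 0"
      "\<forall>\<xi>\<in>W r. DeqF_discr A G us l \<xi> vs = 0"
    using maximizer_multiplier[OF us(1) attained maximal int] .
  have "0 \<notin> Sro r"
  proof
    assume "0 \<in> Sro r"
    from attained show False unfolding zero_in_S_imp[OF \<open>0 \<in> Sro r\<close>] by (simp add: top_ereal_def)
  qed
  note INF_eq = INF_closure_cone[OF _ this]
  have ray: "rayleigh A G us v = l" if "v \<in> Sro r" for v
  proof -
    have v: "v \<in> W r \<inter> closure (Sro r) - {0}" using S_closure[OF that] that \<open>0 \<notin> Sro r\<close> by blast
    then show ?thesis using vs(2) eqF_eq_0_iff[OF us(1) v] by blast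
  qed
  have "discrete_saddle_pair A G W Sro r us vs"
    unfolding discrete_saddle_pair_def
  proof (intro conjI)
    show "us \<in> Sro r" "vs \<in> Sro r" by fact+
    show "lam_star A G W Sro r = ereal (rayleigh A G us vs)" by (simp add: l ray vs(1))
    show "is_arg_min (rayleigh A G us) (\<lambda>v. v \<in> Sro r) vs"
      using vs(1) by (simp add: is_arg_min_def ray)
    show "is_arg_max (\<lambda>u. INF v\<in>Sro r. ereal (rayleigh A G u v)) (\<lambda>u. u \<in> Sro r) us"
      unfolding is_arg_max_def using us(1) attained maximal INF_eq by (metis not_less)
    show "lam_star A G W Sro r = (SUP u\<in>Sro r. INF v\<in>Sro r. ereal (rayleigh A G u v))"
      unfolding star by (rule SUP_cong) (simp_all add: INF_eq)
    show "\<forall>\<zeta>\<in>W r. eqF A G us (real_of_ereal (lam_star A G W Sro r)) \<zeta> = 0"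
      "\<forall>\<xi>\<in>W r. DeqF_discr A G us (real_of_ereal (lam_star A G W Sro r)) \<xi> vs = 0"
      using vs by (simp_all add: l)
  qed
  then show ?thesis by blast
qed

text \<open>Collects what the limit argument uses: criticality in both variables feeds the (PS)
  condition, and stability of the adjoint equation and of the cone under positive factors permits
  the rescaling of \<open>vs\<close>.\<close>

lemma discrete_saddle_pair_critical:
  fixes A G :: "'w::banach \<Rightarrow> 'w \<Rightarrow>\<^sub>L real"
  assumes "basic_setting jW jC So Uo A G" "galerkin_spaces W I" "cond_C jW jC So Uo W Sro I"
    "cond_CQ A G W Sro" "r \<ge> 1" and saddle: "discrete_saddle_pair A G W Sro r us vs"
  shows "us \<in> Sro r" "vs \<in> Sro r" "lam_star A G W Sro r = ereal (rayleigh A G us vs)"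
    and "\<zeta> \<in> W r \<Longrightarrow> eqF A G us (rayleigh A G us vs) \<zeta> = 0"
    and "\<xi> \<in> W r \<Longrightarrow> Du_rayleigh A G us vs \<xi> = 0"
    and "\<zeta> \<in> W r \<Longrightarrow> Dv_rayleigh A G us vs \<zeta> = 0"
    and "\<xi> \<in> W r \<Longrightarrow> DeqF_discr A G us (rayleigh A G us vs) \<xi> (c *\<^sub>R vs) = 0"
    and "c > 0 \<Longrightarrow> c *\<^sub>R vs \<in> Sro r"
proof -
  obtain \<eta> :: "nat \<Rightarrow> 'w" where oc: "orthant_cone A G (W r) (Sro r) \<eta> {1..dim (W r)}"
    and Sr: "Sr W Sro r = W r \<inter> closure (Sro r)"
    using galerkin_orthant_cone[OF assms(1-5)] .
  interpret orthant_cone A G "W r" "Sro r" \<eta> "{1..dim (W r)}" by (rule oc)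
  show us: "us \<in> Sro r" and vs: "vs \<in> Sro r"
    and star: "lam_star A G W Sro r = ereal (rayleigh A G us vs)"
    using saddle unfolding discrete_saddle_pair_def by blast+
  have F0: "\<forall>\<zeta>\<in>W r. eqF A G us (rayleigh A G us vs) \<zeta> = 0"
    and DF0: "\<forall>\<xi>\<in>W r. DeqF_discr A G us (rayleigh A G us vs) \<xi> vs = 0"
    using saddle unfolding discrete_saddle_pair_def star by simp_all
  have "0 \<notin> Sro r"
  proof
    assume "0 \<in> Sro r"
    then have "lam A G W Sro r us = \<infinity>"
      by (simp add: lam_def Sr zero_in_S_imp top_ereal_def)
    moreover have "lam A G W Sro r us \<le> lam_star A G W Sro r"
      unfolding lam_star_def using us by (rule SUP_upper)
    ultimately show False by (simp add: star)
  qed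
  with S_closure[OF vs] vs have cone: "vs \<in> W r \<inter> closure (Sro r) - {0}" by blast
  show "eqF A G us (rayleigh A G us vs) \<zeta> = 0" if "\<zeta> \<in> W r" using F0 that by blast
  show "Du_rayleigh A G us vs \<xi> = 0" if "\<xi> \<in> W r"
    using Du_rayleigh_eq[OF us that cone refl] DF0 that by simp
  show "Dv_rayleigh A G us vs \<zeta> = 0" if "\<zeta> \<in> W r"
    using Dv_rayleigh_eq_0[OF us that cone F0] .
  show "DeqF_discr A G us (rayleigh A G us vs) \<xi> (c *\<^sub>R vs) = 0" if "\<xi> \<in> W r"
    using DeqF_discr_scale[OF us that] cone DF0 that by simp
  have "pos_cone (Sro r)" using assms(3,5) unfolding cond_C_def by blast
  then show "c *\<^sub>R vs \<in> Sro r" if "c > 0" using vs that unfolding pos_cone_def by blast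
qed

section \<open>Existence for large levels and passage to the limit\<close>

theorem theorem2p4:
  fixes jW :: "'w::banach \<Rightarrow> 'e::real_vector"
    and jC :: "'c::{banach,ordered_real_vector} \<Rightarrow> 'e"
    and So Uo :: "'w set"
    and A G :: "'w \<Rightarrow> 'w \<Rightarrow>\<^sub>L real"
    and W Sro :: "nat \<Rightarrow> 'w set"
    and I :: "nat \<Rightarrow> 'c \<Rightarrow> 'w"
  assumes setting: "basic_setting jW jC So Uo A G"
    and R: "cond_R So Uo A G"
    and D: "cond_D So (coneS jW jC So) G"
    and scheme: "galerkin_spaces W I"
    and C: "cond_C jW jC So Uo W Sro I"
    and CQ: "cond_CQ A G W Sro"
    and CD: "cond_CD Uo (coneS jW jC So) A G W Sro"
    and H: "cond_H A G W Sro"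
    and lam_bounds: "\<forall>\<^sub>F r in sequentially. 0 \<le> lam_star A G W Sro r \<and> lam_star A G W Sro r < \<infinity>"
  shows
    "(\<forall>\<^sub>F r in sequentially. \<exists>us vs. discrete_saddle_pair A G W Sro r us vs) \<and>
     (\<forall>(us :: nat \<Rightarrow> 'w) (vs :: nat \<Rightarrow> 'w) (\<rho> :: nat \<Rightarrow> nat) (lh :: real).
        (\<forall>\<^sub>F r in sequentially. discrete_saddle_pair A G W Sro r (us r) (vs r)) \<and>
        strict_mono \<rho> \<and> (\<lambda>n. lam_star A G W Sro (\<rho> n)) \<longlonglongrightarrow> ereal lh \<and>
        PS_e So (coneS jW jC So) A G W Sro lh \<longrightarrow>
        (\<exists>(\<sigma> :: nat \<Rightarrow> nat) (t :: nat \<Rightarrow> real). \<exists>u\<in>Uo. \<exists>v\<in>coneS jW jC So - {0}.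
           strict_mono \<sigma> \<and> (\<forall>k. t k > 0) \<and>
           (\<lambda>k. us (\<rho> (\<sigma> k))) \<longlonglongrightarrow> u \<and>
           weakly_tendsto (\<lambda>k. t k *\<^sub>R vs (\<rho> (\<sigma> k))) v \<and>
           eqF A G u lh = 0 \<and>
           (\<forall>\<xi>. DeqF A G u lh \<xi> v = 0)))"
proof (intro conjI allI impI)
  show "\<forall>\<^sub>F r in sequentially. \<exists>us vs. discrete_saddle_pair A G W Sro r us vs"
    using H[unfolded cond_H_def] lam_bounds eventually_ge_at_top[of 1]
  proof eventually_elim
    case (elim r)
    show ?case
      by (rule discrete_saddle_pair_exists[OF setting scheme C CQ elim(3)]) (use elim(1,2) in blast)+
  qed
next
  fix us vs :: "nat \<Rightarrow> 'w" and \<rho> :: "nat \<Rightarrow> nat" and lh :: real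
  assume asm: "(\<forall>\<^sub>F r in sequentially. discrete_saddle_pair A G W Sro r (us r) (vs r)) \<and>
        strict_mono \<rho> \<and> (\<lambda>n. lam_star A G W Sro (\<rho> n)) \<longlonglongrightarrow> ereal lh \<and>
        PS_e So (coneS jW jC So) A G W Sro lh"
  then have \<rho>: "strict_mono \<rho>" and lim: "(\<lambda>n. lam_star A G W Sro (\<rho> n)) \<longlonglongrightarrow> ereal lh"
    and PS: "PS_e So (coneS jW jC So) A G W Sro lh" by auto
  from asm obtain m where m: "\<And>r. r \<ge> m \<Longrightarrow> discrete_saddle_pair A G W Sro r (us r) (vs r)"
    unfolding eventually_sequentially by blast
  \<comment> \<open>\<open>PS_e\<close> asks for its hypotheses at every \<open>n\<close>, so an
    initial segment is dropped. The shift by \<open>Suc m\<close> puts every index beyond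
    \<open>m\<close> and also ensures that it is at least 1.\<close>
  define \<rho>' where "\<rho>' n = \<rho> (n + Suc m)" for n
  have \<rho>'_ge: "n + Suc m \<le> \<rho>' n" for n
    unfolding \<rho>'_def using seq_suble[OF \<rho>] .
  have mono: "strict_mono \<rho>'"
    using \<rho> by (simp add: strict_mono_def \<rho>'_def)
  have ge1: "\<rho>' n \<ge> 1" for n using \<rho>'_ge[of n] by simp
  have saddle: "discrete_saddle_pair A G W Sro (\<rho>' n) (us (\<rho>' n)) (vs (\<rho>' n))" for n
    by (rule m) (use \<rho>'_ge[of n] in simp)
  note crit = discrete_saddle_pair_critical[OF setting scheme C CQ ge1 saddle]
  define l where "l n = rayleigh A G (us (\<rho>' n)) (vs (\<rho>' n))" for n
  have "(\<lambda>n. ereal (l n)) \<longlonglongrightarrow> ereal lh"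
    using LIMSEQ_ignore_initial_segment[OF lim, of "Suc m"] crit(3)
    unfolding l_def \<rho>'_def by simp
  then have l: "l \<longlonglongrightarrow> lh" by simp
  have "\<exists>\<sigma> t. \<exists>ub\<in>So. \<exists>vb\<in>coneS jW jC So - {0}. strict_mono \<sigma> \<and> (\<forall>k. t k > 0) \<and>
      (\<lambda>k. us (\<rho>' (\<sigma> k))) \<longlonglongrightarrow> ub \<and> weakly_tendsto (\<lambda>k. t k *\<^sub>R vs (\<rho>' (\<sigma> k))) vb"
    by (rule PS[unfolded PS_e_def, rule_format, of \<rho>' "\<lambda>n. us (\<rho>' n)" "\<lambda>n. vs (\<rho>' n)"])
      (use filterlim_subseq[OF mono] ge1 crit l[unfolded l_def[abs_def]] in auto)
  then obtain \<sigma> :: "nat \<Rightarrow> nat" and t :: "nat \<Rightarrow> real" and u v where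
    u: "u \<in> So" and v: "v \<in> coneS jW jC So - {0}" and \<sigma>: "strict_mono \<sigma>" and t: "\<And>k. t k > 0"
    and u_lim: "(\<lambda>k. us (\<rho>' (\<sigma> k))) \<longlonglongrightarrow> u" and v_lim: "weakly_tendsto (\<lambda>k. t k *\<^sub>R vs (\<rho>' (\<sigma> k))) v"
    by blast
  have l\<sigma>: "(\<lambda>k. l (\<sigma> k)) \<longlonglongrightarrow> lh"
    using LIMSEQ_subseq_LIMSEQ[OF l \<sigma>] by (simp add: o_def)
  have mono': "strict_mono (\<lambda>k. \<rho>' (\<sigma> k))"
    using strict_mono_o[OF mono \<sigma>] by (simp add: o_def)
  \<comment> \<open>Density holds along the full sequence of spaces and is inherited by the chosen
    subsequence.\<close>
  have approx: "\<exists>\<xi>n. (\<forall>k. \<xi>n k \<in> W (\<rho>' (\<sigma> k))) \<and> \<xi>n \<longlonglongrightarrow> \<xi>" for \<xi>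
  proof -
    obtain \<xi>r where \<xi>r: "\<forall>r\<ge>1. \<xi>r r \<in> W r" "\<xi>r \<longlonglongrightarrow> \<xi>"
      using scheme unfolding galerkin_spaces_def by blast
    have "(\<lambda>k. \<xi>r (\<rho>' (\<sigma> k))) \<longlonglongrightarrow> \<xi>"
      using LIMSEQ_subseq_LIMSEQ[OF \<xi>r(2) mono'] by (simp add: o_def)
    with \<xi>r(1) ge1 show ?thesis by (intro exI[of _ "\<lambda>k. \<xi>r (\<rho>' (\<sigma> k))"]) simp
  qed
  have "continuous_on UNIV A" "continuous_on UNIV G"
    using setting unfolding basic_setting_def by blast+
  then have AG_lim: "(\<lambda>k. A (us (\<rho>' (\<sigma> k)))) \<longlonglongrightarrow> A u" "(\<lambda>k. G (us (\<rho>' (\<sigma> k)))) \<longlonglongrightarrow> G u"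
    using u_lim by (auto simp: continuous_on_eq_continuous_at intro: isCont_tendsto_compose)
  \<comment> \<open>The functionals converge in norm and the test vectors strongly, so the pairings,
    all equal to 0, converge to the limiting one.\<close>
  have F0: "eqF A G u lh \<zeta> = 0" for \<zeta>
  proof -
    obtain \<zeta>n where \<zeta>n: "\<And>k. \<zeta>n k \<in> W (\<rho>' (\<sigma> k))" "\<zeta>n \<longlonglongrightarrow> \<zeta>" using approx by blast
    have "(\<lambda>k. eqF A G (us (\<rho>' (\<sigma> k))) (l (\<sigma> k)) (\<zeta>n k)) \<longlonglongrightarrow> eqF A G u lh \<zeta>"
      unfolding eqF_def by (intro tendsto_intros AG_lim l\<sigma> \<zeta>n)
    moreover have "eqF A G (us (\<rho>' (\<sigma> k))) (l (\<sigma> k)) (\<zeta>n k) = 0" for k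
      unfolding l_def using crit(4) \<zeta>n(1) .
    ultimately show ?thesis by (simp add: LIMSEQ_const_iff)
  qed
  \<comment> \<open>The limit from (PS) lies only in \<open>So\<close>; as a solution it belongs to
    \<open>Uo\<close> by (R), and this gives access to (CD).\<close>
  with R u have uU: "u \<in> Uo" unfolding cond_R_def by blast
  have DF0: "DeqF A G u lh \<xi> v = 0" for \<xi>
  proof -
    obtain \<xi>n where \<xi>n: "\<And>k. \<xi>n k \<in> W (\<rho>' (\<sigma> k))" "\<xi>n \<longlonglongrightarrow> \<xi>" using approx by blast
    \<comment> \<open>(CD) admits mere weak convergence of the rescaled second components, which
      stay in the open cones.\<close>
    have "(\<lambda>k. DeqF_discr A G (us (\<rho>' (\<sigma> k))) (l (\<sigma> k)) (\<xi>n k) (t k *\<^sub>R vs (\<rho>' (\<sigma> k))))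
        \<longlonglongrightarrow> DeqF A G u lh \<xi> v"
    proof (rule CD[unfolded cond_CD_def, rule_format, of u v "\<lambda>k. \<rho>' (\<sigma> k)"]; (intro conjI allI)?)
      show "u \<in> Uo" "v \<in> coneS jW jC So" using uU v by auto
      show "filterlim (\<lambda>k. \<rho>' (\<sigma> k)) at_top sequentially" by (rule filterlim_subseq[OF mono'])
    qed (use ge1 crit(1,8) t \<xi>n l\<sigma> u_lim v_lim in auto)
    moreover have "DeqF_discr A G (us (\<rho>' (\<sigma> k))) (l (\<sigma> k)) (\<xi>n k) (t k *\<^sub>R vs (\<rho>' (\<sigma> k))) = 0" for k
      unfolding l_def using crit(7) \<xi>n(1) .
    ultimately show ?thesis by (simp add: LIMSEQ_const_iff)
  qed
  \<comment> \<open>Undoes the shift: \<open>\<rho>' (\<sigma> k)\<close> is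
    \<open>\<rho> (\<sigma> k + Suc m)\<close>.\<close>
  have "strict_mono (\<lambda>k. \<sigma> k + Suc m)" using \<sigma> by (simp add: strict_mono_def)
  moreover have "eqF A G u lh = 0" using F0 by (intro blinfun_eqI) simp
  ultimately show "\<exists>(\<sigma> :: nat \<Rightarrow> nat) (t :: nat \<Rightarrow> real). \<exists>u\<in>Uo. \<exists>v\<in>coneS jW jC So - {0}.
           strict_mono \<sigma> \<and> (\<forall>k. t k > 0) \<and>
           (\<lambda>k. us (\<rho> (\<sigma> k))) \<longlonglongrightarrow> u \<and>
           weakly_tendsto (\<lambda>k. t k *\<^sub>R vs (\<rho> (\<sigma> k))) v \<and>
           eqF A G u lh = 0 \<and>
           (\<forall>\<xi>. DeqF A G u lh \<xi> v = 0)"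
    using uU v t u_lim v_lim DF0 unfolding \<rho>'_def
    by (intro exI[of _ "\<lambda>k. \<sigma> k + Suc m"] exI[of _ t] bexI[of _ u] bexI[of _ v] conjI allI) auto
qed

end
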